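(* Let $X=\prod_n Y_n$ be the product of a countable family of profinite spaces $Y_n$, such that the procounting distribution $\mu_{Y_n}$ exists for every $n$, and consider a subset $S=\prod_n T_n$, where $T_n\subseteq Y_n$ for all $n$. If the procounting distribution $\mu_{T_n}$ exists for every $n$, then the procounting distribution $\mu_S$ exists too, and one has $$\mu_S=\bigotimes_n\mu_{T_n},$$ meaning that for any compact open $U=\prod_n U_n\subseteq X$, with $U_n\subseteq Y_n$, one has $\mu_S(\mathbf 1_U)=\prod_n\mu_{T_n}(\mathbf 1_{U_n})$.
   Context: Conventions. $R$ is a commutative unitary topological ring which is a $\mathbb Q$-algebra and whose topology is induced by a non-trivial absolute value. A profinite space $X$ comes with a presentation $X=\varprojlim_{\alpha\in\mathcal J}X_\alpha$, with $X_\alpha$ finite (discrete), $\mathcal J$ directed and containing a cofinal subset isomorphic to $\mathbb N$, and surjective transition maps $\pi_\alpha^\beta\colon X_\beta\to X_\alpha$ ($\beta\ge\alpha$); $\pi_\alpha\colon X\to X_\alpha$ is the projection. $\mathbf 1_U$ denotes a characteristic function. An $R$-valued distribution on $X$ is an $R$-linear functional on the locally constant functions $X\to R$; equivalently, a finitely additive $R$-valued function $U\mapsto\mu(\mathbf 1_U)$ on compact open subsets of $X$. The space $\mathcal D(X,R)$ of distributions has the weak-* topology (pointwise convergence on the functions $\mathbf 1_U$, $U$ compact open). Procounting distributions. The procounting distribution $\mu_X$ of the whole space is the distribution whose push-forward to each $X_\alpha$ is $\frac1{|X_\alpha|}\sum_{x\in X_\alpha}\delta_x$, if it exists. Assume $\mu_X$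 exists. For nonempty $S\subseteq X$ put $$\widetilde\mu_{S,\alpha}:=\frac{|X_\alpha|}{|\pi_\alpha(S)|}\,\mathbf 1_{\pi_\alpha^{-1}(\pi_\alpha(S))}\cdot\mu_X,\qquad\text{where }(f\cdot\mu)(g):=\mu(fg),$$ and $\widetilde\mu_{\emptyset,\alpha}:=0$. (If $U=\pi_\alpha^{-1}(\pi_\alpha(U))$ then $\widetilde\mu_{S,\alpha}(\mathbf 1_U)=|\pi_\alpha(U)\cap\pi_\alpha(S)|/|\pi_\alpha(S)|$.) The procounting distribution of $S$ is $\mu_S:=\lim_{\alpha\in\mathcal J}\widetilde\mu_{S,\alpha}$ in $\mathcal D(X,R)$, if the limit of this net exists. Products. If $Y_n=\varprojlim_{\alpha_n\in\mathcal J_n}Y_{n,\alpha_n}$, then $X=\prod_nY_n$ is presented as $\varprojlim_{\alpha}X_\alpha$, where $\alpha=(\alpha_n)_{n\in K}$ varies in $\bigcup_K\prod_{n\in K}\mathcal J_n$ ($K$ ranging over finite sets of indices), $X_\alpha=\prod_{n\in K}Y_{n,\alpha_n}$, and $(\beta_n)_{n\in K'}\ge(\alpha_n)_{n\in K}$ iff $K\subseteq K'$ and $\beta_n\ge\alpha_n$ for all $n\in K$. *)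

theory Defs
  imports "HOL-Analysis.Analysis"
begin

text \<open>The structure map of a \<open>\<rat>\<close>-algebra; it is unique if it exists.\<close>

class Q_algebra = comm_ring_1 +
  fixes of_Q :: "rat \<Rightarrow> 'a"
  assumes of_Q_1: "of_Q 1 = 1"
    and of_Q_add: "of_Q (p + q) = of_Q p + of_Q q"
    and of_Q_mult: "of_Q (p * q) = of_Q p * of_Q q"

text \<open>The absolute value may be archimedean or not. Since it induces the topology, the ring
  operations are automatically continuous.\<close>

locale nontrivial_absolute_value =
  fixes v :: "'r::{comm_ring_1,topological_space} \<Rightarrow> real"
  assumes nonneg: "v x \<ge> 0"
    and eq_0_iff: "v x = 0 \<longleftrightarrow> x = 0"
    and mult: "v (x * y) = v x * v y"
    and triangle: "v (x + y) \<le> v x + v y"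
    and nontrivial: "\<exists>x. x \<noteq> 0 \<and> v x \<noteq> 1"
    and induces_topology:
      "open U \<longleftrightarrow> (\<forall>x\<in>U. \<exists>e>0. \<forall>y. v (y - x) < e \<longrightarrow> y \<in> U)"

record ('a, 'j, 'b) presentation =
  total :: "'a topology"
  index :: "'j set"
  leq :: "'j \<Rightarrow> 'j \<Rightarrow> bool"
  level :: "'j \<Rightarrow> 'b set"
  proj :: "'j \<Rightarrow> 'a \<Rightarrow> 'b"
  transition :: "'j \<Rightarrow> 'j \<Rightarrow> 'b \<Rightarrow> 'b"

text \<open>For \<open>leq P \<alpha> \<beta>\<close>, the map \<open>transition P \<alpha> \<beta>\<close> goes from level \<open>\<beta>\<close> to level \<open>\<alpha>\<close>.
  The space is required to be nonempty, as otherwise \<open>1 / |X\<^sub>\<alpha>|\<close> makes no sense.\<close>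

locale profinite_presentation =
  fixes P :: "('a, 'j, 'b) presentation"
  assumes leq_refl: "\<alpha> \<in> index P \<Longrightarrow> leq P \<alpha> \<alpha>"
    and leq_trans: "\<lbrakk>\<alpha> \<in> index P; \<beta> \<in> index P; \<gamma> \<in> index P; leq P \<alpha> \<beta>; leq P \<beta> \<gamma>\<rbrakk>
      \<Longrightarrow> leq P \<alpha> \<gamma>"
    and directed: "\<lbrakk>\<alpha> \<in> index P; \<beta> \<in> index P\<rbrakk>
      \<Longrightarrow> \<exists>\<gamma>\<in>index P. leq P \<alpha> \<gamma> \<and> leq P \<beta> \<gamma>"
    and cofinal_nat: "\<exists>c :: nat \<Rightarrow> 'j. range c \<subseteq> index P \<and>
      (\<forall>m n. leq P (c m) (c n) \<longleftrightarrow> m \<le> n) \<and> (\<forall>\<alpha>\<in>index P. \<exists>n. leq P \<alpha> (c n))"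
    and finite_level: "\<alpha> \<in> index P \<Longrightarrow> finite (level P \<alpha>)"
    and transition_surj: "\<lbrakk>\<alpha> \<in> index P; \<beta> \<in> index P; leq P \<alpha> \<beta>\<rbrakk>
      \<Longrightarrow> transition P \<alpha> \<beta> ` level P \<beta> = level P \<alpha>"
    and transition_id: "\<lbrakk>\<alpha> \<in> index P; y \<in> level P \<alpha>\<rbrakk> \<Longrightarrow> transition P \<alpha> \<alpha> y = y"
    and transition_comp: "\<lbrakk>\<alpha> \<in> index P; \<beta> \<in> index P; \<gamma> \<in> index P; leq P \<alpha> \<beta>; leq P \<beta> \<gamma>;
      y \<in> level P \<gamma>\<rbrakk> \<Longrightarrow> transition P \<alpha> \<beta> (transition P \<beta> \<gamma> y) = transition P \<alpha> \<gamma> y"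
    and inverse_limit: "homeomorphic_map (total P)
      (subtopology (product_topology (\<lambda>\<alpha>. discrete_topology (level P \<alpha>)) (index P))
        {y. \<forall>\<alpha>\<in>index P. \<forall>\<beta>\<in>index P. leq P \<alpha> \<beta> \<longrightarrow> transition P \<alpha> \<beta> (y \<beta>) = y \<alpha>})
      (\<lambda>x. \<lambda>\<alpha>\<in>index P. proj P \<alpha> x)"
    and nonempty: "topspace (total P) \<noteq> {}"

definition tails :: "('a, 'j, 'b) presentation \<Rightarrow> 'j filter" where
  "tails P = (INF \<alpha>\<in>index P. principal {\<beta> \<in> index P. leq P \<alpha> \<beta>})"

text \<open>A family \<open>(\<alpha>\<^sub>n)\<^sub>n\<^sub>\<in>\<^sub>K\<close> with \<open>K\<close> a finite set of indices is encoded as a partial map with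
  domain \<open>K\<close>.\<close>

definition product_presentation ::
  "'i set \<Rightarrow> ('i \<Rightarrow> ('a, 'j, 'b) presentation)
    \<Rightarrow> ('i \<Rightarrow> 'a, 'i \<rightharpoonup> 'j, 'i \<Rightarrow> 'b) presentation" where
  "product_presentation I P = \<lparr>
     total = product_topology (\<lambda>n. total (P n)) I,
     index = {\<alpha>. finite (dom \<alpha>) \<and> dom \<alpha> \<subseteq> I \<and> (\<forall>n\<in>dom \<alpha>. the (\<alpha> n) \<in> index (P n))},
     leq = (\<lambda>\<alpha> \<beta>. dom \<alpha> \<subseteq> dom \<beta> \<and> (\<forall>n\<in>dom \<alpha>. leq (P n) (the (\<alpha> n)) (the (\<beta> n)))),
     level = (\<lambda>\<alpha>. \<Pi>\<^sub>E n\<in>dom \<alpha>. level (P n) (the (\<alpha> n))),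
     proj = (\<lambda>\<alpha> x. \<lambda>n\<in>dom \<alpha>. proj (P n) (the (\<alpha> n)) (x n)),
     transition = (\<lambda>\<alpha> \<beta> y. \<lambda>n\<in>dom \<alpha>. transition (P n) (the (\<alpha> n)) (the (\<beta> n)) (y n))\<rparr>"

definition compact_open :: "'a topology \<Rightarrow> 'a set \<Rightarrow> bool" where
  "compact_open X U \<longleftrightarrow> compactin X U \<and> openin X U"

text \<open>Functions on \<open>X\<close> are extended by zero outside \<open>topspace X\<close>, so that \<open>indicator U\<close> is the
  characteristic function of \<open>U\<close>.\<close>

definition locally_constant :: "'a topology \<Rightarrow> ('a \<Rightarrow> 'r::zero) set" where
  "locally_constant X = {f. (\<forall>x. x \<notin> topspace X \<longrightarrow> f x = 0) \<and>
     (\<forall>x\<in>topspace X. \<exists>V. openin X V \<and> x \<in> V \<and> (\<forall>y\<in>V. f y = f x))}"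

text \<open>Extensionality makes distributions equal as soon as they agree on
  \<open>locally_constant X\<close>.\<close>

definition distributions :: "'a topology \<Rightarrow> (('a \<Rightarrow> 'r::comm_ring_1) \<Rightarrow> 'r) set" where
  "distributions X = {\<mu> \<in> extensional (locally_constant X).
     (\<forall>f\<in>locally_constant X. \<forall>g\<in>locally_constant X. \<mu> (\<lambda>x. f x + g x) = \<mu> f + \<mu> g) \<and>
     (\<forall>c. \<forall>f\<in>locally_constant X. \<mu> (\<lambda>x. c * f x) = c * \<mu> f)}"

definition weak_star :: "'a topology \<Rightarrow> (('a \<Rightarrow> 'r::{comm_ring_1,topological_space}) \<Rightarrow> 'r) topology"
  where "weak_star X = pullback_topology (distributions X)
    (\<lambda>\<mu>. \<lambda>U\<in>{U. compact_open X U}. \<mu> (indicator U))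
    (product_topology (\<lambda>_. euclidean) {U. compact_open X U})"

definition dirac :: "'a topology \<Rightarrow> 'a \<Rightarrow> ('a \<Rightarrow> 'r::comm_ring_1) \<Rightarrow> 'r" where
  "dirac X x = (\<lambda>f\<in>locally_constant X. f x)"

definition times_dist :: "'a topology \<Rightarrow> ('a \<Rightarrow> 'r) \<Rightarrow> (('a \<Rightarrow> 'r) \<Rightarrow> 'r)
    \<Rightarrow> ('a \<Rightarrow> 'r::comm_ring_1) \<Rightarrow> 'r" where
  "times_dist X f \<mu> = (\<lambda>g\<in>locally_constant X. \<mu> (\<lambda>x. f x * g x))"

definition scale_dist :: "'a topology \<Rightarrow> 'r \<Rightarrow> (('a \<Rightarrow> 'r) \<Rightarrow> 'r)
    \<Rightarrow> ('a \<Rightarrow> 'r::comm_ring_1) \<Rightarrow> 'r" where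
  "scale_dist X c \<mu> = (\<lambda>g\<in>locally_constant X. c * \<mu> g)"

definition push_forward :: "'a topology \<Rightarrow> 'b topology \<Rightarrow> ('a \<Rightarrow> 'b)
    \<Rightarrow> (('a \<Rightarrow> 'r) \<Rightarrow> 'r) \<Rightarrow> ('b \<Rightarrow> 'r::comm_ring_1) \<Rightarrow> 'r" where
  "push_forward X Y h \<mu> =
     (\<lambda>g\<in>locally_constant Y. \<mu> (\<lambda>x. if x \<in> topspace X then g (h x) else 0))"

definition uniform_dist :: "'b set \<Rightarrow> ('b \<Rightarrow> 'r::Q_algebra) \<Rightarrow> 'r" where
  "uniform_dist A = scale_dist (discrete_topology A) (of_Q (1 / of_nat (card A)))
     (\<lambda>g. \<Sum>x\<in>A. dirac (discrete_topology A) x g)"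

definition procounting_whole :: "('a, 'j, 'b) presentation
    \<Rightarrow> (('a \<Rightarrow> 'r::Q_algebra) \<Rightarrow> 'r) \<Rightarrow> bool" where
  "procounting_whole P \<mu> \<longleftrightarrow> \<mu> \<in> distributions (total P) \<and>
     (\<forall>\<alpha>\<in>index P. push_forward (total P) (discrete_topology (level P \<alpha>)) (proj P \<alpha>) \<mu>
        = uniform_dist (level P \<alpha>))"

definition approx_dist :: "('a, 'j, 'b) presentation \<Rightarrow> (('a \<Rightarrow> 'r) \<Rightarrow> 'r) \<Rightarrow> 'a set \<Rightarrow> 'j
    \<Rightarrow> ('a \<Rightarrow> 'r::Q_algebra) \<Rightarrow> 'r" where
  "approx_dist P \<mu> S \<alpha> = (if S = {} then (\<lambda>g\<in>locally_constant (total P). 0)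
     else scale_dist (total P)
       (of_Q (of_nat (card (level P \<alpha>)) / of_nat (card (proj P \<alpha> ` S))))
       (times_dist (total P)
         (indicator {x \<in> topspace (total P). proj P \<alpha> x \<in> proj P \<alpha> ` S}) \<mu>))"

text \<open>\<open>procounting P S \<mu>\<close>: the distribution \<open>\<mu>\<^sub>S\<close> exists (in particular, so does \<open>\<mu>\<^sub>X\<close>) and
  equals \<open>\<mu>\<close>.\<close>

definition procounting :: "('a, 'j, 'b) presentation \<Rightarrow> 'a set
    \<Rightarrow> (('a \<Rightarrow> 'r::{Q_algebra,topological_space}) \<Rightarrow> 'r) \<Rightarrow> bool" where
  "procounting P S \<mu> \<longleftrightarrow> (\<exists>\<mu>X. procounting_whole P \<mu>X \<and>
     limitin (weak_star (total P)) (approx_dist P \<mu>X S) \<mu> (tails P))"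

end

theory Submission
  imports Defs
begin

text \<open>A surjective tower carries a procounting distribution exactly when the fibres of each
  transition map all have the same cardinality, a condition that products inherit. On a clopen set
  \<open>U\<close> pulled back from level \<open>\<alpha>\<close>, the approximating net of \<open>\<mu>\<^sub>S\<close> at \<open>\<beta> \<ge> \<alpha>\<close> is the relative
  frequency \<open>|\<pi>\<^sub>\<beta>(U) \<inter> \<pi>\<^sub>\<beta>(S)| / |\<pi>\<^sub>\<beta>(S)|\<close>. For a box in a product of boxes this is a finite product
  of the frequencies of the factors, and each fibre of a projection is a box, so the net converges
  on all fibres and hence, by linearity, on all locally constant functions.\<close>

section \<open>Rings with an absolute value\<close>

text \<open>No completeness of the ring is available, so a limit can only be shown to exist by
  exhibiting its value: on a fibre of the product it is a finite product of values of the given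
  distributions, and other functions are handled as finite combinations of fibres.

  The frequency of a box at level \<beta> has one factor for each coordinate in
  \<open>dom \<beta>\<close>, and this set grows along the net. A coordinate in which the box is
  unrestricted has frequency exactly 1, which leaves a fixed finite set of factors.

  For the distribution of the whole product no tensor product is built: equality of fibre
  cardinalities concerns finite sets only, and the distribution is then obtained as an average over
  a level.

  The calculus of boxes breaks down for empty sets, since the projection of a product is the product
  of the projections only if the remaining sides are nonempty. Empty \<open>S\<close> or
  \<open>U\<close> is therefore split off; some side is then empty and contributes a zero
  factor.\<close>

context nontrivial_absolute_value
begin

text \<open>\<open>v 1\<close> is a nonzero idempotent real, hence 1, and \<open>v (- 1)\<close> is
  a nonnegative square root of it.\<close>

lemma v_minus: "v (- x) = v x"
proof -
  have "v 1 * v 1 = v 1"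
    by (metis mult mult_1)
  then have "v 1 = 1"
    using eq_0_iff[of 1] by simp
  then have "v (- 1) * v (- 1) = 1"
    using mult[of "- 1" "- 1"] by simp
  then have "v (- 1) = 1"
    using nonneg[of "- 1"] by (metis abs_of_nonneg abs_mult_self_eq abs_1 real_sqrt_mult_self
        real_sqrt_abs2 real_sqrt_one)
  then show ?thesis
    using mult[of "- 1" x] by simp
qed

text \<open>The topology of the ring is known only through \<open>induces_topology\<close>. This
  reduces its limits to limits of reals, from which the limit laws below are derived.\<close>

lemma tendsto_iff_v:
  fixes f :: "'c \<Rightarrow> 'r"
  shows "(f \<longlongrightarrow> l) F \<longleftrightarrow> ((\<lambda>x. v (f x - l)) \<longlongrightarrow> 0) F"
proof
  assume lim: "(f \<longlongrightarrow> l) F"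
  show "((\<lambda>x. v (f x - l)) \<longlongrightarrow> 0) F"
  proof (rule tendstoI)
    fix e :: real
    assume "e > 0"
    have "open {y. v (y - l) < e}"
      unfolding induces_topology
    proof clarify
      fix y
      assume y: "v (y - l) < e"
      have "v (z - l) < e" if "v (z - y) < e - v (y - l)" for z
        using triangle[of "z - y" "y - l"] that by simp
      then show "\<exists>d>0. \<forall>z. v (z - y) < d \<longrightarrow> z \<in> {y. v (y - l) < e}"
        using y by (intro exI[of _ "e - v (y - l)"]) simp
    qed
    moreover have "v (l - l) < e"
      using \<open>e > 0\<close> eq_0_iff[of "l - l"] by simp
    ultimately have "eventually (\<lambda>x. f x \<in> {y. v (y - l) < e}) F"
      using topological_tendstoD[OF lim] by blast
    then show "\<forall>\<^sub>F x in F. dist (v (f x - l)) 0 < e"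
      using nonneg by (simp add: dist_real_def)
  qed
next
  assume lim: "((\<lambda>x. v (f x - l)) \<longlongrightarrow> 0) F"
  show "(f \<longlongrightarrow> l) F"
  proof (rule topological_tendstoI)
    fix S
    assume "open S" "l \<in> S"
    then obtain e where "e > 0" "\<And>y. v (y - l) < e \<Longrightarrow> y \<in> S"
      using induces_topology by blast
    moreover have "eventually (\<lambda>x. v (f x - l) < e) F"
      using order_tendstoD(2)[OF lim \<open>e > 0\<close>] .
    ultimately show "eventually (\<lambda>x. f x \<in> S) F"
      by (auto elim: eventually_mono)
  qed
qed

lemma tendsto_v_null:
  fixes h :: "'c \<Rightarrow> 'r"
  assumes "(g \<longlongrightarrow> 0) F" "\<And>x. v (h x) \<le> g x"
  shows "((\<lambda>x. v (h x)) \<longlongrightarrow> 0) F"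
  using assms nonneg by (intro tendsto_sandwich[OF _ _ tendsto_const assms(1)]) simp_all

lemma tendsto_add_v:
  fixes f g :: "'c \<Rightarrow> 'r"
  assumes "(f \<longlongrightarrow> a) F" "(g \<longlongrightarrow> b) F"
  shows "((\<lambda>x. f x + g x) \<longlongrightarrow> a + b) F"
proof -
  have "((\<lambda>x. v (f x - a) + v (g x - b)) \<longlongrightarrow> 0) F"
    using tendsto_add[OF assms[unfolded tendsto_iff_v]] by simp
  moreover have "v (f x + g x - (a + b)) \<le> v (f x - a) + v (g x - b)" for x
    using triangle[of "f x - a" "g x - b"] nonneg by (simp add: algebra_simps)
  ultimately show ?thesis
    unfolding tendsto_iff_v by (rule tendsto_v_null)
qed

lemma tendsto_mult_v:
  fixes f g :: "'c \<Rightarrow> 'r"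
  assumes "(f \<longlongrightarrow> a) F" "(g \<longlongrightarrow> b) F"
  shows "((\<lambda>x. f x * g x) \<longlongrightarrow> a * b) F"
proof -
  let ?p = "\<lambda>x. v (f x - a)" and ?q = "\<lambda>x. v (g x - b)"
  \<comment> \<open>The bound comes from expanding the product around \<open>a\<close> and
    \<open>b\<close>.\<close>
  have "((\<lambda>x. ?p x * ?q x + v a * ?q x + ?p x * v b) \<longlongrightarrow> 0) F"
    using assms[unfolded tendsto_iff_v] by (auto intro!: tendsto_eq_intros)
  moreover have "v (f x * g x - a * b) \<le> ?p x * ?q x + v a * ?q x + ?p x * v b" for x
  proof -
    have "f x * g x - a * b = (f x - a) * (g x - b) + a * (g x - b) + (f x - a) * b"
      by (simp add: algebra_simps)
    then show ?thesis
      using triangle[of "(f x - a) * (g x - b) + a * (g x - b)" "(f x - a) * b"]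
        triangle[of "(f x - a) * (g x - b)" "a * (g x - b)"] nonneg
      by (simp add: mult)
  qed
  ultimately show ?thesis
    unfolding tendsto_iff_v by (rule tendsto_v_null)
qed

lemma tendsto_sum_v:
  fixes f :: "'d \<Rightarrow> 'c \<Rightarrow> 'r"
  shows "(\<And>i. i \<in> A \<Longrightarrow> (f i \<longlongrightarrow> a i) F) \<Longrightarrow> ((\<lambda>x. \<Sum>i\<in>A. f i x) \<longlongrightarrow> (\<Sum>i\<in>A. a i)) F"
  by (induction A rule: infinite_finite_induct) (auto intro: tendsto_add_v)

lemma tendsto_prod_v:
  fixes f :: "'d \<Rightarrow> 'c \<Rightarrow> 'r"
  shows "(\<And>i. i \<in> A \<Longrightarrow> (f i \<longlongrightarrow> a i) F) \<Longrightarrow> ((\<lambda>x. \<Prod>i\<in>A. f i x) \<longlongrightarrow> (\<Prod>i\<in>A. a i)) F"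
  by (induction A rule: infinite_finite_induct) (auto intro: tendsto_mult_v)

text \<open>An absolute value separates points: the constant \<open>v (b - a)\<close> is dominated
  by a function that tends to 0.\<close>

lemma tendsto_unique_v:
  fixes f :: "'c \<Rightarrow> 'r"
  assumes "F \<noteq> bot" "(f \<longlongrightarrow> a) F" "(f \<longlongrightarrow> b) F"
  shows "a = b"
proof -
  have "((\<lambda>x. v (f x - a) + v (f x - b)) \<longlongrightarrow> 0) F"
    using tendsto_add[OF assms(2,3)[unfolded tendsto_iff_v]] by simp
  moreover have "v (b - a) \<le> v (f x - a) + v (f x - b)" for x
    using triangle[of "f x - a" "- (f x - b)"] nonneg[of "b - a"] v_minus[of "f x - b"]
    by simp
  ultimately have "((\<lambda>x. v (b - a)) \<longlongrightarrow> 0) F"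
    by (rule tendsto_v_null)
  then have "v (b - a) = 0"
    using assms(1) by (simp add: tendsto_const_iff)
  then show ?thesis
    using eq_0_iff[of "b - a"] by simp
qed

end

section \<open>The structure map of a rational algebra\<close>

lemma of_Q_0: "of_Q 0 = (0::'r::Q_algebra)"
  using of_Q_add[of 0 0] by simp

lemma of_Q_of_nat: "of_Q (of_nat n) = (of_nat n :: 'r::Q_algebra)"
  by (induction n) (simp_all add: of_Q_0 of_Q_1 of_Q_add)

lemma of_Q_prod: "of_Q (\<Prod>i\<in>A. f i) = (\<Prod>i\<in>A. of_Q (f i) :: 'r::Q_algebra)"
  by (induction A rule: infinite_finite_induct) (simp_all add: of_Q_1 of_Q_mult)

text \<open>A unital homomorphism from a field to a nonzero ring is injective. This lets equal
  values of a distribution be read as equal ratios of cardinalities.\<close>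

lemma of_Q_eq_iff: "of_Q p = (of_Q q :: 'r::Q_algebra) \<longleftrightarrow> p = q"
proof
  assume eq: "of_Q p = (of_Q q :: 'r)"
  have "of_Q (p - q) = (0 :: 'r)"
    using of_Q_add[of "p - q" q, where 'a = 'r] eq by simp
  then have "of_Q ((p - q) * inverse (p - q)) = (0 :: 'r)"
    unfolding of_Q_mult by simp
  then show "p = q"
    using of_Q_1[where 'a = 'r] by (cases "p = q") auto
qed simp

section \<open>Towers of finite quotients\<close>

text \<open>What is kept of a presentation: a compact space whose topology has the fibres of the
  projections as a basis. Transition maps and cofinal sequences are no longer mentioned, so that
  products can be checked coordinatewise.\<close>

locale profinite_tower =
  fixes P :: "('a, 'j, 'b) presentation"
  assumes leq_trans: "\<lbrakk>\<alpha> \<in> index P; \<beta> \<in> index P; \<gamma> \<in> index P; leq P \<alpha> \<beta>; leq P \<beta> \<gamma>\<rbrakk>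
      \<Longrightarrow> leq P \<alpha> \<gamma>"
    and directed: "\<lbrakk>\<alpha> \<in> index P; \<beta> \<in> index P\<rbrakk>
      \<Longrightarrow> \<exists>\<gamma>\<in>index P. leq P \<alpha> \<gamma> \<and> leq P \<beta> \<gamma>"
    and index_nonempty: "index P \<noteq> {}"
    and nonempty: "topspace (total P) \<noteq> {}"
    and compact: "compact_space (total P)"
    and finite_level: "\<alpha> \<in> index P \<Longrightarrow> finite (level P \<alpha>)"
    and proj_image: "\<alpha> \<in> index P \<Longrightarrow> proj P \<alpha> ` topspace (total P) = level P \<alpha>"
    and proj_leq: "\<lbrakk>\<alpha> \<in> index P; \<beta> \<in> index P; leq P \<alpha> \<beta>; x \<in> topspace (total P);
      y \<in> topspace (total P); proj P \<beta> x = proj P \<beta> y\<rbrakk> \<Longrightarrow> proj P \<alpha> x = proj P \<alpha> y"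
    and openin_fibre: "\<alpha> \<in> index P \<Longrightarrow> openin (total P) {x \<in> topspace (total P). proj P \<alpha> x = a}"
    and neighbourhood: "\<lbrakk>openin (total P) V; x \<in> V\<rbrakk>
      \<Longrightarrow> \<exists>\<alpha>\<in>index P. \<forall>y\<in>topspace (total P). proj P \<alpha> y = proj P \<alpha> x \<longrightarrow> y \<in> V"
begin

lemma directed_finite:
  assumes "finite A" "A \<subseteq> index P"
  shows "\<exists>\<gamma>\<in>index P. \<forall>\<alpha>\<in>A. leq P \<alpha> \<gamma>"
  using assms
proof (induction rule: finite_induct)
  case empty
  then show ?case
    using index_nonempty by blast
next
  case (insert \<alpha> A)
  then obtain \<gamma> where \<gamma>: "\<gamma> \<in> index P" "\<forall>\<alpha>\<in>A. leq P \<alpha> \<gamma>"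
    by auto
  from insert.prems \<gamma> obtain \<delta> where "\<delta> \<in> index P" "leq P \<alpha> \<delta>" "leq P \<gamma> \<delta>"
    using directed by blast
  then show ?case
    using \<gamma> insert.prems leq_trans[OF _ \<gamma>(1) _ _ \<open>leq P \<gamma> \<delta>\<close>] by blast
qed

text \<open>Directedness makes the principal filters in \<open>tails\<close> a filter base.\<close>

lemma eventually_tails:
  "eventually Q (tails P) \<longleftrightarrow> (\<exists>\<alpha>\<in>index P. \<forall>\<beta>\<in>index P. leq P \<alpha> \<beta> \<longrightarrow> Q \<beta>)"
  unfolding tails_def
proof (subst eventually_INF_base)
  fix \<alpha> \<beta>
  assume *: "\<alpha> \<in> index P" "\<beta> \<in> index P"
  then obtain \<gamma> where "\<gamma> \<in> index P" "leq P \<alpha> \<gamma>" "leq P \<beta> \<gamma>"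
    using directed by blast
  then show "\<exists>x\<in>index P. principal {\<beta> \<in> index P. leq P x \<beta>}
      \<le> inf (principal {\<beta> \<in> index P. leq P \<alpha> \<beta>}) (principal {\<gamma> \<in> index P. leq P \<beta> \<gamma>})"
    using * leq_trans[of _ \<gamma>] unfolding le_inf_iff principal_le_iff by blast
qed (auto simp: index_nonempty eventually_principal)

lemma tails_nonbot: "tails P \<noteq> bot"
  unfolding trivial_limit_def eventually_tails using directed by blast

lemma level_nonempty: "\<alpha> \<in> index P \<Longrightarrow> level P \<alpha> \<noteq> {}"
  using proj_image nonempty by blast

lemma card_level_pos: "\<alpha> \<in> index P \<Longrightarrow> card (level P \<alpha>) > 0"
  using finite_level level_nonempty card_gt_0_iff by blast

lemma proj_in_level: "\<alpha> \<in> index P \<Longrightarrow> x \<in> topspace (total P) \<Longrightarrow> proj P \<alpha> x \<in> level P \<alpha>"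
  using proj_image by blast

text \<open>\<open>f\<close> descends to a function on level \<alpha>. Applied to
  \<open>\<lambda>x. x \<in> U\<close> it says that \<open>U\<close> is a union of fibres, up to
  points outside the space.\<close>

definition factors :: "'j \<Rightarrow> ('a \<Rightarrow> 'c) \<Rightarrow> bool" where
  "factors \<alpha> f \<longleftrightarrow> (\<forall>x\<in>topspace (total P). \<forall>y\<in>topspace (total P).
     proj P \<alpha> x = proj P \<alpha> y \<longrightarrow> f x = f y)"

lemma factorsD:
  "factors \<alpha> f \<Longrightarrow> x \<in> topspace (total P) \<Longrightarrow> y \<in> topspace (total P) \<Longrightarrow> proj P \<alpha> x = proj P \<alpha> y
    \<Longrightarrow> f x = f y"
  unfolding factors_def by blast

lemma factors_leq:
  "factors \<alpha> f \<Longrightarrow> \<alpha> \<in> index P \<Longrightarrow> \<beta> \<in> index P \<Longrightarrow> leq P \<alpha> \<beta> \<Longrightarrow> factors \<beta> f"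
  unfolding factors_def using proj_leq by blast

lemma openin_saturated:
  assumes "\<alpha> \<in> index P" "factors \<alpha> (\<lambda>x. x \<in> U)" "U \<subseteq> topspace (total P)"
  shows "openin (total P) U"
  unfolding openin_subopen[of _ U]
proof
  fix x
  assume "x \<in> U"
  then show "\<exists>T. openin (total P) T \<and> x \<in> T \<and> T \<subseteq> U"
    using assms openin_fibre[OF assms(1), of "proj P \<alpha> x"]
    by (intro exI[of _ "{y \<in> topspace (total P). proj P \<alpha> y = proj P \<alpha> x}"])
      (auto simp: factors_def)
qed

text \<open>The complement is a union of fibres too, so \<open>U\<close> is clopen in a compact
  space.\<close>

lemma compact_open_saturated:
  assumes "\<alpha> \<in> index P" "factors \<alpha> (\<lambda>x. x \<in> U)" "U \<subseteq> topspace (total P)"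
  shows "compact_open (total P) U"
proof -
  have "factors \<alpha> (\<lambda>x. x \<in> topspace (total P) - U)"
    using assms(2) unfolding factors_def by blast
  then have "closedin (total P) U"
    unfolding closedin_def using assms openin_saturated by blast
  then show ?thesis
    unfolding compact_open_def using assms openin_saturated closedin_compact_space[OF compact]
    by blast
qed

text \<open>Finitely many of the fibres on which \<open>f\<close> is constant cover
  \<open>K\<close>, and an index above their levels serves all of \<open>K\<close>. Since
  \<open>y\<close> is not confined to \<open>K\<close>, the choice \<open>K = U\<close> shows that a
  fibre meeting a compact open \<open>U\<close> lies inside it.\<close>

lemma ex_factors_compactin:
  assumes "compactin (total P) K"
    and loc: "\<And>x. x \<in> K \<Longrightarrow> \<exists>V. openin (total P) V \<and> x \<in> V \<and> (\<forall>y\<in>V. f y = f x)"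
  shows "\<exists>\<alpha>\<in>index P. \<forall>x\<in>K. \<forall>y\<in>topspace (total P). proj P \<alpha> x = proj P \<alpha> y \<longrightarrow> f x = f y"
proof -
  let ?X = "topspace (total P)"
  have K: "K \<subseteq> ?X"
    using assms(1) compactin_subset_topspace by blast
  have "\<exists>\<alpha>\<in>index P. \<forall>y\<in>?X. proj P \<alpha> y = proj P \<alpha> x \<longrightarrow> f y = f x" if "x \<in> K" for x
    using loc[OF that] neighbourhood by meson
  then obtain \<alpha> where \<alpha>: "\<And>x. x \<in> K \<Longrightarrow> \<alpha> x \<in> index P"
    and f\<alpha>: "\<And>x y. x \<in> K \<Longrightarrow> y \<in> ?X \<Longrightarrow> proj P (\<alpha> x) y = proj P (\<alpha> x) x \<Longrightarrow> f y = f x"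
    by metis
  define N where "N = (\<lambda>x. {y \<in> ?X. proj P (\<alpha> x) y = proj P (\<alpha> x) x})"
  have "\<forall>V\<in>N ` K. openin (total P) V"
    unfolding N_def using \<alpha> openin_fibre by blast
  moreover have "K \<subseteq> \<Union>(N ` K)"
    unfolding N_def using K by blast
  ultimately obtain \<F> where "finite \<F>" "\<F> \<subseteq> N ` K" "K \<subseteq> \<Union>\<F>"
    using assms(1) unfolding compactin_def by meson
  then obtain F where F: "finite F" "F \<subseteq> K" "K \<subseteq> \<Union>(N ` F)"
    by (metis finite_subset_image)
  then obtain \<gamma> where \<gamma>: "\<gamma> \<in> index P" "\<forall>z\<in>F. leq P (\<alpha> z) \<gamma>"
    using directed_finite[of "\<alpha> ` F"] \<alpha> by auto
  have "f x = f y" if x: "x \<in> K" and y: "y \<in> ?X" and eq: "proj P \<gamma> x = proj P \<gamma> y" for x y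
  proof -
    \<comment> \<open>The points \<open>x\<close> and \<open>y\<close> both lie in the fibre
      \<open>N z\<close>: they agree at \<gamma>, hence at the lower level
      \<open>\<alpha> z\<close>.\<close>
    obtain z where z: "z \<in> F" "x \<in> N z"
      using F x by blast
    then have "proj P (\<alpha> z) x = proj P (\<alpha> z) y"
      using \<gamma> \<alpha> F proj_leq x y eq K by (meson subsetD)
    then show ?thesis
      using z f\<alpha>[of z x] f\<alpha>[of z y] F y by (auto simp: N_def)
  qed
  then show ?thesis
    using \<gamma>(1) by blast
qed

lemma locally_constant_factors:
  assumes "f \<in> locally_constant (total P)"
  shows "\<exists>\<alpha>\<in>index P. factors \<alpha> f"
  unfolding factors_def
proof (rule ex_factors_compactin)
  show "compactin (total P) (topspace (total P))"
    using compact by (simp add: compact_space_def)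
qed (use assms in \<open>simp add: locally_constant_def\<close>)

lemma compact_open_factors:
  assumes "compact_open (total P) U"
  shows "\<exists>\<alpha>\<in>index P. factors \<alpha> (\<lambda>x. x \<in> U)"
proof -
  have "\<exists>\<alpha>\<in>index P. \<forall>x\<in>U. \<forall>y\<in>topspace (total P).
      proj P \<alpha> x = proj P \<alpha> y \<longrightarrow> (x \<in> U) = (y \<in> U)"
    using assms by (intro ex_factors_compactin) (auto simp: compact_open_def)
  then show ?thesis
    unfolding factors_def by metis
qed

lemma factors_locally_constant:
  assumes "\<alpha> \<in> index P" "factors \<alpha> f" "\<And>x. x \<notin> topspace (total P) \<Longrightarrow> f x = 0"
  shows "f \<in> locally_constant (total P)"
  unfolding locally_constant_def
proof (clarsimp simp: assms(3))
  fix x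
  assume x: "x \<in> topspace (total P)"
  show "\<exists>V. openin (total P) V \<and> x \<in> V \<and> (\<forall>y\<in>V. f y = f x)"
    using x assms(2) openin_fibre[OF assms(1), of "proj P \<alpha> x"]
    by (intro exI[of _ "{y \<in> topspace (total P). proj P \<alpha> y = proj P \<alpha> x}"])
      (auto intro: factorsD)
qed

lemma indicator_locally_constant:
  assumes "compact_open (total P) U"
  shows "(indicator U :: 'a \<Rightarrow> 'c::zero_neq_one) \<in> locally_constant (total P)"
proof -
  have "U \<subseteq> topspace (total P)"
    using assms by (simp add: compact_open_def compactin_subset_topspace)
  moreover obtain \<alpha> where "\<alpha> \<in> index P" "factors \<alpha> (\<lambda>x. x \<in> U)"
    using compact_open_factors[OF assms] by blast
  moreover from this have "factors \<alpha> (indicator U :: 'a \<Rightarrow> 'c)"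
    unfolding factors_def[of _ "indicator U"] indicator_def
    by (intro ballI impI arg_cong[where f = of_bool]) (rule factorsD)
  ultimately show ?thesis
    by (intro factors_locally_constant[of \<alpha>] indicator_simps(2)) (auto simp del: indicator_simps)
qed

end

section \<open>From an inverse limit to a tower\<close>

context profinite_presentation
begin

abbreviation (input) levels :: "('j \<Rightarrow> 'b) topology" where
  "levels \<equiv> product_topology (\<lambda>\<alpha>. discrete_topology (level P \<alpha>)) (index P)"

text \<open>Only the compatibility condition. The inverse limit itself is
  \<open>topspace levels \<inter> threads\<close>.\<close>

definition threads :: "('j \<Rightarrow> 'b) set" where
  "threads = {y. \<forall>\<alpha>\<in>index P. \<forall>\<beta>\<in>index P. leq P \<alpha> \<beta> \<longrightarrow> transition P \<alpha> \<beta> (y \<beta>) = y \<alpha>}"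

abbreviation (input) coordinates :: "'a \<Rightarrow> 'j \<Rightarrow> 'b" where
  "coordinates x \<equiv> \<lambda>\<alpha>\<in>index P. proj P \<alpha> x"

lemma homeomorphic_coordinates:
  "homeomorphic_map (total P) (subtopology levels threads) coordinates"
  unfolding threads_def by (rule inverse_limit)

lemma coordinates_image:
  "coordinates ` topspace (total P) = (\<Pi>\<^sub>E \<alpha>\<in>index P. level P \<alpha>) \<inter> threads"
  using homeomorphic_imp_surjective_map[OF homeomorphic_coordinates] by simp

lemma coordinates_in:
  "x \<in> topspace (total P) \<Longrightarrow> coordinates x \<in> (\<Pi>\<^sub>E \<alpha>\<in>index P. level P \<alpha>) \<inter> threads"
  using coordinates_image by blast

lemma proj_transition:
  assumes "\<alpha> \<in> index P" "\<beta> \<in> index P" "leq P \<alpha> \<beta>" "x \<in> topspace (total P)"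
  shows "proj P \<alpha> x = transition P \<alpha> \<beta> (proj P \<beta> x)"
  using coordinates_in[OF assms(4)] assms(1-3) by (auto simp: threads_def)

text \<open>An intersection of equalizers of continuous maps into discrete, hence Hausdorff,
  spaces.\<close>

lemma closedin_threads: "closedin levels (topspace levels \<inter> threads)"
proof -
  let ?E = "\<lambda>\<alpha> \<beta>. {y \<in> topspace levels. transition P \<alpha> \<beta> (y \<beta>) = y \<alpha>}"
  let ?R = "{(\<alpha>, \<beta>). \<alpha> \<in> index P \<and> \<beta> \<in> index P \<and> leq P \<alpha> \<beta>}"
  have closed: "closedin levels {y \<in> topspace levels. transition P \<alpha> \<beta> (y \<beta>) = y \<alpha>}"
    if "\<alpha> \<in> index P" "\<beta> \<in> index P" "leq P \<alpha> \<beta>" for \<alpha> \<beta>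
  proof (rule closedin_continuous_maps_eq)
    show "Hausdorff_space (discrete_topology (level P \<alpha>))"
      by simp
    show "continuous_map levels (discrete_topology (level P \<alpha>)) (\<lambda>y. y \<alpha>)"
      using that by (intro continuous_map_product_projection)
    have "continuous_map (discrete_topology (level P \<beta>)) (discrete_topology (level P \<alpha>))
        (transition P \<alpha> \<beta>)"
      using transition_surj[OF that] by auto
    from continuous_map_compose[OF continuous_map_product_projection[OF that(2),
          of "\<lambda>\<alpha>. discrete_topology (level P \<alpha>)"] this]
    show "continuous_map levels (discrete_topology (level P \<alpha>)) (\<lambda>y. transition P \<alpha> \<beta> (y \<beta>))"
      by (simp add: comp_def)
  qed
  \<comment> \<open>Inserting \<open>topspace levels\<close> keeps the family nonempty and its
    intersection inside the space.\<close>
  have "closedin levels (\<Inter>(insert (topspace levels) (case_prod ?E ` ?R)))"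
  proof (rule closedin_Inter)
    fix S
    assume "S \<in> insert (topspace levels) (case_prod ?E ` ?R)"
    then consider "S = topspace levels"
      | \<alpha> \<beta> where "\<alpha> \<in> index P" "\<beta> \<in> index P" "leq P \<alpha> \<beta>" "S = ?E \<alpha> \<beta>"
      by blast
    then show "closedin levels S"
      by cases (simp only: closedin_topspace, simp only: closed)
  qed simp
  moreover have "topspace levels \<inter> threads = \<Inter>(insert (topspace levels) (case_prod ?E ` ?R))"
    unfolding threads_def by blast
  ultimately show ?thesis
    by simp
qed

text \<open>Tychonoff for the finite levels, then passage to a closed subspace.\<close>

lemma compact_total: "compact_space (total P)"
proof -
  have "compact_space levels"
    using finite_level by (auto simp: compact_space_product_topology compact_space_discrete_topology)
  then have "compact_space (subtopology levels threads)"
    using closedin_threads closedin_compact_space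
    by (metis compact_space_subtopology subtopology_restrict)
  then show ?thesis
    using homeomorphic_compact_space homeomorphic_coordinates homeomorphic_map_imp_homeomorphic_space
    by blast
qed

text \<open>A point of a finite level is lifted step by step along the cofinal sequence.\<close>

lemma proj_surj:
  assumes \<alpha>: "\<alpha> \<in> index P"
  shows "proj P \<alpha> ` topspace (total P) = level P \<alpha>"
proof
  show "proj P \<alpha> ` topspace (total P) \<subseteq> level P \<alpha>"
    using coordinates_in \<alpha> by fastforce
  show "level P \<alpha> \<subseteq> proj P \<alpha> ` topspace (total P)"
  proof
    fix a
    assume a: "a \<in> level P \<alpha>"
    from cofinal_nat obtain c0 :: "nat \<Rightarrow> 'j" where c0: "range c0 \<subseteq> index P"
      "\<forall>m n. leq P (c0 m) (c0 n) \<longleftrightarrow> m \<le> n" "\<forall>\<beta>\<in>index P. \<exists>n. leq P \<beta> (c0 n)"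
      by (elim exE conjE) (rule that)
    obtain N where N: "leq P \<alpha> (c0 N)"
      using c0(3) \<alpha> by blast
    \<comment> \<open>The shift by \<open>N\<close> makes the whole sequence lie above \<alpha>; it
      stays cofinal because \<open>n \<le> N + n\<close>.\<close>
    define c where "c = (\<lambda>k. c0 (N + k))"
    have c: "c k \<in> index P" for k
      using c0(1) by (auto simp: c_def)
    have c_mono: "leq P (c m) (c n)" if "m \<le> n" for m n
      using c0(2) that by (simp add: c_def)
    have cofinal: "\<exists>k. leq P \<beta> (c k)" if \<beta>: "\<beta> \<in> index P" for \<beta>
    proof -
      obtain n where "leq P \<beta> (c0 n)"
        using c0(3) \<beta> by blast
      moreover have "leq P (c0 n) (c n)"
        using c0(2) by (simp add: c_def)
      moreover have "c0 n \<in> index P"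
        using c0(1) by blast
      ultimately show ?thesis
        using leq_trans[of \<beta> "c0 n" "c n"] \<beta> c by blast
    qed
    obtain b0 where b0: "b0 \<in> level P (c 0)" "transition P \<alpha> (c 0) b0 = a"
      using transition_surj[OF \<alpha> c[of 0]] N a unfolding c_def by force
    \<comment> \<open>Dependent choice, with the start pinned to the chosen lift \<open>b0\<close>
      of \<open>a\<close> by a clause that is vacuous for later \<open>k\<close>.\<close>
    have "\<exists>b. (b 0 = b0) \<and> (\<forall>k. b k \<in> level P (c k)) \<and> (\<forall>k. transition P (c k) (c (Suc k)) (b (Suc k)) = b k)"
    proof -
      have "\<exists>b. \<forall>k. (b k \<in> level P (c k) \<and> (k = 0 \<longrightarrow> b k = b0)) \<and>
          transition P (c k) (c (Suc k)) (b (Suc k)) = b k"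
      proof (rule dependent_nat_choice)
        show "\<exists>x. x \<in> level P (c 0) \<and> (0 = (0::nat) \<longrightarrow> x = b0)"
          using b0 by blast
        show "\<exists>y. (y \<in> level P (c (Suc n)) \<and> (Suc n = 0 \<longrightarrow> y = b0)) \<and>
            transition P (c n) (c (Suc n)) y = x"
          if "x \<in> level P (c n) \<and> (n = 0 \<longrightarrow> x = b0)" for x n
        proof -
          have "x \<in> transition P (c n) (c (Suc n)) ` level P (c (Suc n))"
            using transition_surj[OF c c c_mono, of n "Suc n"] that by simp
          then show ?thesis
            by blast
        qed
      qed
      then show ?thesis
        by blast
    qed
    then obtain b where b: "b 0 = b0" "\<And>k. b k \<in> level P (c k)"
      "\<And>k. transition P (c k) (c (Suc k)) (b (Suc k)) = b k"
      by blast
    have b_le: "transition P (c m) (c n) (b n) = b m" if "m \<le> n" for m n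
      using that
    proof (induction n rule: dec_induct)
      case base
      then show ?case
        using transition_id c b by blast
    next
      case (step n)
      have "transition P (c m) (c (Suc n)) (b (Suc n))
          = transition P (c m) (c n) (transition P (c n) (c (Suc n)) (b (Suc n)))"
        using step.hyps c b(2) by (intro transition_comp[symmetric] c_mono) auto
      then show ?case
        using b(3) step.IH by simp
    qed
    \<comment> \<open>The thread is read off at \<beta> from some term of the sequence above
      \<beta>; by \<open>y\<close> below, any such term gives the same value.\<close>
    define k where "k = (\<lambda>\<beta>. SOME k. leq P \<beta> (c k))"
    have k: "leq P \<beta> (c (k \<beta>))" if "\<beta> \<in> index P" for \<beta>
      unfolding k_def using cofinal[OF that] by (rule someI_ex)
    define y where "y = (\<lambda>\<beta>\<in>index P. transition P \<beta> (c (k \<beta>)) (b (k \<beta>)))"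
    have y: "y \<beta> = transition P \<beta> (c n) (b n)" if \<beta>: "\<beta> \<in> index P" and le: "leq P \<beta> (c n)" for \<beta> n
    proof -
      \<comment> \<open>Two terms above \<beta> are compared through the later of them.\<close>
      have "transition P \<beta> (c m) (b m) = transition P \<beta> (c (max m n)) (b (max m n))"
        if "leq P \<beta> (c m)" for m n
      proof -
        have "transition P \<beta> (c m) (transition P (c m) (c (max m n)) (b (max m n)))
            = transition P \<beta> (c (max m n)) (b (max m n))"
          using that \<beta> c b(2) by (intro transition_comp c_mono) auto
        then show ?thesis
          using b_le[of m "max m n"] by simp
      qed
      from this[OF le, of "k \<beta>"] this[OF k[OF \<beta>], of n] show ?thesis
        unfolding y_def using \<beta> by (simp add: max.commute)
    qed
    have "y \<beta> \<in> level P \<beta>" if "\<beta> \<in> index P" for \<beta>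
      using y[OF that k[OF that]] transition_surj[OF that c k[OF that]] b(2) by blast
    moreover have "transition P \<beta> \<gamma> (y \<gamma>) = y \<beta>"
      if "\<beta> \<in> index P" "\<gamma> \<in> index P" "leq P \<beta> \<gamma>" for \<beta> \<gamma>
    proof -
      have "leq P \<beta> (c (k \<gamma>))"
        using leq_trans[OF that(1,2) c that(3) k] that by blast
      then show ?thesis
        using y[of \<beta> "k \<gamma>"] y[of \<gamma> "k \<gamma>"] k[of \<gamma>] that c b(2) by (simp add: transition_comp)
    qed
    ultimately have "y \<in> (\<Pi>\<^sub>E \<beta>\<in>index P. level P \<beta>) \<inter> threads"
      by (auto simp: threads_def y_def)
    then obtain x where x: "x \<in> topspace (total P)" "coordinates x = y"
      using coordinates_image by (metis (no_types, lifting) imageE)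
    have "proj P \<alpha> x = y \<alpha>"
      using x(2)[symmetric] \<alpha> by simp
    also have "\<dots> = a"
      using y[of \<alpha> 0] \<alpha> N b(1) b0(2) by (simp add: c_def)
    finally show "a \<in> proj P \<alpha> ` topspace (total P)"
      using x(1) by blast
  qed
qed

lemma profinite_tower: "profinite_tower P"
proof unfold_locales
  show "index P \<noteq> {}"
    using cofinal_nat by blast
  show "proj P \<alpha> x = proj P \<alpha> y"
    if "\<alpha> \<in> index P" "\<beta> \<in> index P" "leq P \<alpha> \<beta>" "x \<in> topspace (total P)"
      "y \<in> topspace (total P)" "proj P \<beta> x = proj P \<beta> y" for \<alpha> \<beta> x y
    using that proj_transition by metis
  show "openin (total P) {x \<in> topspace (total P). proj P \<alpha> x = a}" if \<alpha>: "\<alpha> \<in> index P" for \<alpha> a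
  proof -
    have "continuous_map (total P) (discrete_topology (level P \<alpha>)) ((\<lambda>y. y \<alpha>) \<circ> coordinates)"
      using homeomorphic_imp_continuous_map[OF homeomorphic_coordinates] \<alpha>
      by (intro continuous_map_compose[OF _ continuous_map_from_subtopology[OF
            continuous_map_product_projection]])
    \<comment> \<open>Intersecting with the level covers the case that \<open>a\<close> lies outside
      it, when the fibre is empty.\<close>
    then have "openin (total P)
        {x \<in> topspace (total P). ((\<lambda>y. y \<alpha>) \<circ> coordinates) x \<in> level P \<alpha> \<inter> {a}}"
      by (rule openin_continuous_map_preimage) simp
    moreover have "{x \<in> topspace (total P). ((\<lambda>y. y \<alpha>) \<circ> coordinates) x \<in> level P \<alpha> \<inter> {a}}
        = {x \<in> topspace (total P). proj P \<alpha> x = a}"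
      using \<alpha> proj_surj by auto
    ultimately show ?thesis
      by simp
  qed
  show "\<exists>\<alpha>\<in>index P. \<forall>y\<in>topspace (total P). proj P \<alpha> y = proj P \<alpha> x \<longrightarrow> y \<in> V"
    if V: "openin (total P) V" "x \<in> V" for V x
  proof -
    let ?X = "topspace (total P)"
    have VX: "V \<subseteq> ?X"
      using V openin_subset by blast
    then have "openin (subtopology levels threads) (coordinates ` V)"
      using homeomorphic_map_openness[OF homeomorphic_coordinates] V by blast
    then obtain W where W: "openin levels W" "coordinates ` V = W \<inter> threads"
      unfolding openin_subtopology by blast
    then have "coordinates x \<in> W"
      using V by blast
    then obtain U where U: "finite {\<alpha> \<in> index P. U \<alpha> \<noteq> level P \<alpha>}"
      "coordinates x \<in> Pi\<^sub>E (index P) U" "Pi\<^sub>E (index P) U \<subseteq> W"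
      using W(1) unfolding openin_product_topology_alt by (auto 4 3)
    obtain \<gamma>0 where "\<gamma>0 \<in> index P"
      using cofinal_nat by blast
    have "\<exists>\<gamma>\<in>index P. \<forall>\<alpha>\<in>A. leq P \<alpha> \<gamma>" if "finite A" "A \<subseteq> index P" for A
      using that
    proof (induction rule: finite_induct)
      case empty
      then show ?case
        using \<open>\<gamma>0 \<in> index P\<close> by blast
    next
      case (insert \<alpha> A)
      then obtain \<gamma> where \<gamma>: "\<gamma> \<in> index P" "\<forall>\<alpha>\<in>A. leq P \<alpha> \<gamma>"
        by auto
      from insert.prems \<gamma> obtain \<delta> where "\<delta> \<in> index P" "leq P \<alpha> \<delta>" "leq P \<gamma> \<delta>"
        using directed by blast
      then show ?case
        using \<gamma> insert.prems leq_trans[OF _ \<gamma>(1) _ _ \<open>leq P \<gamma> \<delta>\<close>] by blast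
    qed
    from this[OF U(1)] obtain \<gamma>
      where \<gamma>: "\<gamma> \<in> index P" "\<And>\<alpha>. \<alpha> \<in> index P \<Longrightarrow> U \<alpha> \<noteq> level P \<alpha> \<Longrightarrow> leq P \<alpha> \<gamma>"
      by auto
    have "y \<in> V" if y: "y \<in> ?X" "proj P \<gamma> y = proj P \<gamma> x" for y
    proof -
      have "proj P \<alpha> y \<in> U \<alpha>" if \<alpha>: "\<alpha> \<in> index P" for \<alpha>
      proof (cases "U \<alpha> = level P \<alpha>")
        case True
        then show ?thesis
          using proj_surj \<alpha> y by auto
      next
        case False
        then have "proj P \<alpha> y = proj P \<alpha> x"
          using \<gamma> \<alpha> y V VX proj_transition[of \<alpha> \<gamma>] by (metis subsetD)
        then show ?thesis
          using U(2) \<alpha> by (auto simp: PiE_iff)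
      qed
      then have "coordinates y \<in> coordinates ` V"
        using W(2) U(3) coordinates_in[OF y(1)] by auto
      then obtain z where "z \<in> V" "coordinates y = coordinates z"
        by blast
      then show ?thesis
        using homeomorphic_imp_injective_map[OF homeomorphic_coordinates] y(1) VX
        by (metis inj_onD subsetD)
    qed
    then show ?thesis
      using \<gamma>(1) by blast
  qed
  show "\<exists>\<gamma>\<in>index P. leq P \<alpha> \<gamma> \<and> leq P \<beta> \<gamma>" if "\<alpha> \<in> index P" "\<beta> \<in> index P" for \<alpha> \<beta>
    using that by (rule directed)
qed (rule leq_trans finite_level nonempty compact_total proj_surj; assumption)+

end

section \<open>Products of towers\<close>

locale tower_family =
  fixes I :: "'i set" and Y :: "'i \<Rightarrow> ('a, 'j, 'b) presentation"
  assumes tower: "n \<in> I \<Longrightarrow> profinite_tower (Y n)"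
begin

abbreviation prd where "prd \<equiv> product_presentation I Y"

lemma total_prd: "total prd = product_topology (\<lambda>n. total (Y n)) I"
  by (simp add: product_presentation_def)

lemma topspace_prd: "topspace (total prd) = (\<Pi>\<^sub>E n\<in>I. topspace (total (Y n)))"
  by (simp add: total_prd)

lemma index_prd:
  "\<alpha> \<in> index prd \<longleftrightarrow> finite (dom \<alpha>) \<and> dom \<alpha> \<subseteq> I \<and> (\<forall>n\<in>dom \<alpha>. the (\<alpha> n) \<in> index (Y n))"
  by (simp add: product_presentation_def)

lemma
  assumes "\<alpha> \<in> index prd"
  shows index_prd_finite: "finite (dom \<alpha>)"
    and index_prd_subset: "dom \<alpha> \<subseteq> I"
    and index_prd_in: "n \<in> dom \<alpha> \<Longrightarrow> n \<in> I"
    and index_prd_component: "n \<in> dom \<alpha> \<Longrightarrow> the (\<alpha> n) \<in> index (Y n)"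
  using assms unfolding index_prd by blast+

lemma leq_prd:
  "leq prd \<alpha> \<beta> \<longleftrightarrow> dom \<alpha> \<subseteq> dom \<beta> \<and> (\<forall>n\<in>dom \<alpha>. leq (Y n) (the (\<alpha> n)) (the (\<beta> n)))"
  by (simp add: product_presentation_def)

lemma level_prd: "level prd \<alpha> = (\<Pi>\<^sub>E n\<in>dom \<alpha>. level (Y n) (the (\<alpha> n)))"
  by (simp add: product_presentation_def)

lemma proj_prd: "proj prd \<alpha> x = (\<lambda>n\<in>dom \<alpha>. proj (Y n) (the (\<alpha> n)) (x n))"
  by (simp add: product_presentation_def)

lemma proj_prd_eq_iff:
  "proj prd \<alpha> x = proj prd \<alpha> y \<longleftrightarrow>
    (\<forall>n\<in>dom \<alpha>. proj (Y n) (the (\<alpha> n)) (x n) = proj (Y n) (the (\<alpha> n)) (y n))"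
  unfolding proj_prd fun_eq_iff by (auto simp: restrict_def)

lemma proj_prd_eq:
  "a \<in> extensional (dom \<alpha>) \<Longrightarrow>
    proj prd \<alpha> x = a \<longleftrightarrow> (\<forall>n\<in>dom \<alpha>. proj (Y n) (the (\<alpha> n)) (x n) = a n)"
  unfolding proj_prd fun_eq_iff extensional_def restrict_def mem_Collect_eq by metis

text \<open>A preimage is assembled coordinate by coordinate. The coordinates outside
  \<open>dom \<alpha>\<close> must be filled as well, whence nonemptiness of every
  \<open>A n\<close>.\<close>

lemma proj_prd_PiE_image:
  assumes "dom \<alpha> \<subseteq> I" "\<And>n. n \<in> I \<Longrightarrow> A n \<noteq> {}"
  shows "proj prd \<alpha> ` (\<Pi>\<^sub>E n\<in>I. A n) = (\<Pi>\<^sub>E n\<in>dom \<alpha>. proj (Y n) (the (\<alpha> n)) ` A n)"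
proof
  show "proj prd \<alpha> ` (\<Pi>\<^sub>E n\<in>I. A n) \<subseteq> (\<Pi>\<^sub>E n\<in>dom \<alpha>. proj (Y n) (the (\<alpha> n)) ` A n)"
    using assms(1) unfolding proj_prd by (intro image_subsetI restrict_PiE_iff[THEN iffD2]) (blast dest: PiE_mem)
  show "(\<Pi>\<^sub>E n\<in>dom \<alpha>. proj (Y n) (the (\<alpha> n)) ` A n) \<subseteq> proj prd \<alpha> ` (\<Pi>\<^sub>E n\<in>I. A n)"
  proof
    fix b
    assume b: "b \<in> (\<Pi>\<^sub>E n\<in>dom \<alpha>. proj (Y n) (the (\<alpha> n)) ` A n)"
    have "\<exists>z. z \<in> A n \<and> (n \<in> dom \<alpha> \<longrightarrow> proj (Y n) (the (\<alpha> n)) z = b n)" if "n \<in> I" for n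
      using PiE_mem[OF b, of n] assms(2)[OF that] by (cases "n \<in> dom \<alpha>") auto
    then obtain x where x: "\<And>n. n \<in> I \<Longrightarrow> x n \<in> A n"
      "\<And>n. n \<in> dom \<alpha> \<Longrightarrow> proj (Y n) (the (\<alpha> n)) (x n) = b n"
      using assms(1) by (metis subsetD)
    have "proj prd \<alpha> (restrict x I) = b"
      using x(2) b assms(1) by (auto simp: proj_prd fun_eq_iff PiE_iff extensional_def restrict_def)
    then show "b \<in> proj prd \<alpha> ` (\<Pi>\<^sub>E n\<in>I. A n)"
      using x(1) by (intro image_eqI[of _ _ "restrict x I"]) auto
  qed
qed

sublocale prd: profinite_tower prd
proof
  show "\<exists>\<gamma>\<in>index prd. leq prd \<alpha> \<gamma> \<and> leq prd \<beta> \<gamma>" if "\<alpha> \<in> index prd" "\<beta> \<in> index prd" for \<alpha> \<beta>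
  proof -
    have "\<exists>\<gamma>. \<gamma> \<in> index (Y n) \<and> (n \<in> dom \<alpha> \<longrightarrow> leq (Y n) (the (\<alpha> n)) \<gamma>) \<and>
        (n \<in> dom \<beta> \<longrightarrow> leq (Y n) (the (\<beta> n)) \<gamma>)" if n: "n \<in> dom \<alpha> \<union> dom \<beta>" for n
    proof -
      have "n \<in> I"
        using n \<open>\<alpha> \<in> index prd\<close> \<open>\<beta> \<in> index prd\<close> by (auto simp: index_prd)
      then interpret Y: profinite_tower "Y n"
        by (rule tower)
      \<comment> \<open>The entries of \<alpha> and \<beta> at \<open>n\<close>, one or two of them,
        for which a common upper bound is chosen.\<close>
      let ?A = "(if n \<in> dom \<alpha> then {the (\<alpha> n)} else {}) \<union> (if n \<in> dom \<beta> then {the (\<beta> n)} else {})"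
      have "\<exists>\<gamma>\<in>index (Y n). \<forall>\<delta>\<in>?A. leq (Y n) \<delta> \<gamma>"
        using \<open>\<alpha> \<in> index prd\<close> \<open>\<beta> \<in> index prd\<close>
        by (intro Y.directed_finite) (auto simp: index_prd)
      then show ?thesis
        by (auto split: if_splits)
    qed
    then obtain g where g: "\<And>n. n \<in> dom \<alpha> \<union> dom \<beta> \<Longrightarrow> g n \<in> index (Y n) \<and>
        (n \<in> dom \<alpha> \<longrightarrow> leq (Y n) (the (\<alpha> n)) (g n)) \<and> (n \<in> dom \<beta> \<longrightarrow> leq (Y n) (the (\<beta> n)) (g n))"
      by metis
    define \<gamma> where "\<gamma> = (\<lambda>n. if n \<in> dom \<alpha> \<union> dom \<beta> then Some (g n) else None)"
    have "dom \<gamma> = dom \<alpha> \<union> dom \<beta>" "\<And>n. n \<in> dom \<alpha> \<union> dom \<beta> \<Longrightarrow> \<gamma> n = Some (g n)"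
      by (auto simp: \<gamma>_def split: if_splits)
    then show ?thesis
      using g that by (intro bexI[of _ \<gamma>]) (simp_all add: index_prd leq_prd)
  qed
  show "leq prd \<alpha> \<gamma>" if "\<alpha> \<in> index prd" "\<beta> \<in> index prd" "\<gamma> \<in> index prd" "leq prd \<alpha> \<beta>" "leq prd \<beta> \<gamma>"
    for \<alpha> \<beta> \<gamma>
    unfolding leq_prd
  proof (intro conjI ballI)
    show "dom \<alpha> \<subseteq> dom \<gamma>"
      using that(4,5) unfolding leq_prd by blast
    fix n
    assume n: "n \<in> dom \<alpha>"
    then have "n \<in> I" "n \<in> dom \<beta>" "n \<in> dom \<gamma>"
      using that n unfolding leq_prd index_prd by blast+
    then show "leq (Y n) (the (\<alpha> n)) (the (\<gamma> n))"
      using profinite_tower.leq_trans[OF tower, of n "the (\<alpha> n)" "the (\<beta> n)" "the (\<gamma> n)"] that n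
      by (simp add: leq_prd index_prd)
  qed
  \<comment> \<open>The empty family is an index even if \<open>I\<close> is empty.\<close>
  have "Map.empty \<in> index prd"
    by (simp add: index_prd)
  then show "index prd \<noteq> {}"
    by blast
  show "topspace (total prd) \<noteq> {}"
    using profinite_tower.nonempty[OF tower] by (simp add: topspace_prd PiE_eq_empty_iff)
  show "compact_space (total prd)"
    using profinite_tower.compact[OF tower] by (simp add: total_prd compact_space_product_topology)
  show "finite (level prd \<alpha>)" if "\<alpha> \<in> index prd" for \<alpha>
    unfolding level_prd
  proof (rule finite_PiE)
    show "finite (level (Y n) (the (\<alpha> n)))" if "n \<in> dom \<alpha>" for n
      using that \<open>\<alpha> \<in> index prd\<close>
      by (intro profinite_tower.finite_level[OF tower] index_prd_in index_prd_component)
  qed (rule index_prd_finite[OF that])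
  show "proj prd \<alpha> ` topspace (total prd) = level prd \<alpha>" if "\<alpha> \<in> index prd" for \<alpha>
  proof -
    have "proj (Y n) (the (\<alpha> n)) ` topspace (total (Y n)) = level (Y n) (the (\<alpha> n))" if "n \<in> dom \<alpha>" for n
      using that \<open>\<alpha> \<in> index prd\<close>
      by (intro profinite_tower.proj_image[OF tower] index_prd_in index_prd_component)
    then have "(\<Pi>\<^sub>E n\<in>dom \<alpha>. proj (Y n) (the (\<alpha> n)) ` topspace (total (Y n))) = level prd \<alpha>"
      unfolding level_prd by (rule PiE_cong)
    moreover have "proj prd \<alpha> ` topspace (total prd)
        = (\<Pi>\<^sub>E n\<in>dom \<alpha>. proj (Y n) (the (\<alpha> n)) ` topspace (total (Y n)))"
      unfolding topspace_prd using index_prd_subset[OF that]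
      by (rule proj_prd_PiE_image) (rule profinite_tower.nonempty[OF tower])
    ultimately show ?thesis
      by simp
  qed
  show "proj prd \<alpha> x = proj prd \<alpha> y"
    if *: "\<alpha> \<in> index prd" "\<beta> \<in> index prd" "leq prd \<alpha> \<beta>" "x \<in> topspace (total prd)"
      "y \<in> topspace (total prd)" "proj prd \<beta> x = proj prd \<beta> y" for \<alpha> \<beta> x y
    unfolding proj_prd_eq_iff
  proof
    fix n
    assume n: "n \<in> dom \<alpha>"
    then have "n \<in> I" "n \<in> dom \<beta>"
      using * unfolding leq_prd index_prd by blast+
    then show "proj (Y n) (the (\<alpha> n)) (x n) = proj (Y n) (the (\<alpha> n)) (y n)"
      using profinite_tower.proj_leq[OF tower, of n "the (\<alpha> n)" "the (\<beta> n)" "x n" "y n"] * n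
      unfolding proj_prd_eq_iff topspace_prd by (simp add: leq_prd index_prd PiE_iff)
  qed
  show "openin (total prd) {x \<in> topspace (total prd). proj prd \<alpha> x = a}" if \<alpha>: "\<alpha> \<in> index prd" for \<alpha> a
  proof (cases "a \<in> extensional (dom \<alpha>)")
    case True
    \<comment> \<open>The fibre over an extensional \<open>a\<close> is a box that restricts only
      the finitely many coordinates in \<open>dom \<alpha>\<close>.\<close>
    let ?B = "\<lambda>n. {z \<in> topspace (total (Y n)). n \<in> dom \<alpha> \<longrightarrow> proj (Y n) (the (\<alpha> n)) z = a n}"
    have "openin (total prd) (Pi\<^sub>E I ?B)"
      unfolding total_prd openin_PiE_gen
    proof (intro disjI2 conjI ballI)
      have "?B n = topspace (total (Y n))" if "n \<notin> dom \<alpha>" for n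
        using that by simp
      then have "{n \<in> I. ?B n \<noteq> topspace (total (Y n))} \<subseteq> dom \<alpha>"
        by blast
      then show "finite {n \<in> I. ?B n \<noteq> topspace (total (Y n))}"
        by (rule finite_subset) (rule index_prd_finite[OF \<alpha>])
      show "openin (total (Y n)) (?B n)" if "n \<in> I" for n
      proof (cases "n \<in> dom \<alpha>")
        case True
        then show ?thesis
          using profinite_tower.openin_fibre[OF tower[OF that] index_prd_component[OF \<alpha> True], of "a n"]
          by simp
      next
        case False
        then show ?thesis
          by simp
      qed
    qed
    moreover have "Pi\<^sub>E I ?B = {x \<in> topspace (total prd). proj prd \<alpha> x = a}"
      unfolding topspace_prd proj_prd_eq[OF True] set_eq_iff mem_Collect_eq PiE_iff
      using index_prd_subset[OF \<alpha>] by blast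
    ultimately show ?thesis
      by simp
  next
    case False
    \<comment> \<open>Projections are extensional on \<open>dom \<alpha>\<close>, so nothing lies
      over such an \<open>a\<close>.\<close>
    then have "{x \<in> topspace (total prd). proj prd \<alpha> x = a} = {}"
      by (auto simp: proj_prd)
    then show ?thesis
      by (metis openin_empty)
  qed
  show "\<exists>\<alpha>\<in>index prd. \<forall>y\<in>topspace (total prd). proj prd \<alpha> y = proj prd \<alpha> x \<longrightarrow> y \<in> V"
    if V: "openin (total prd) V" "x \<in> V" for V x
  proof -
    from bspec[OF V(1)[unfolded total_prd openin_product_topology_alt] V(2)]
    obtain U where U: "finite {n \<in> I. U n \<noteq> topspace (total (Y n))}"
      "\<forall>n\<in>I. openin (total (Y n)) (U n)" "x \<in> Pi\<^sub>E I U" "Pi\<^sub>E I U \<subseteq> V"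
      by (elim exE conjE) (rule that)
    have "\<exists>\<alpha>\<in>index (Y n). \<forall>z\<in>topspace (total (Y n)).
        proj (Y n) \<alpha> z = proj (Y n) \<alpha> (x n) \<longrightarrow> z \<in> U n" if "n \<in> I" for n
      using profinite_tower.neighbourhood[OF tower[OF that] bspec[OF U(2) that] PiE_mem[OF U(3) that]] .
    then obtain g where g: "\<And>n. n \<in> I \<Longrightarrow> g n \<in> index (Y n)" "\<And>n z. n \<in> I \<Longrightarrow>
        z \<in> topspace (total (Y n)) \<Longrightarrow> proj (Y n) (g n) z = proj (Y n) (g n) (x n) \<Longrightarrow> z \<in> U n"
      by metis
    \<comment> \<open>Only the finitely many coordinates in which the box is restricted receive an
      entry, so the domain is finite.\<close>
    define \<alpha> where "\<alpha> = (\<lambda>n. if n \<in> I \<and> U n \<noteq> topspace (total (Y n)) then Some (g n) else None)"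
    have dom: "dom \<alpha> = {n \<in> I. U n \<noteq> topspace (total (Y n))}"
      by (simp add: \<alpha>_def dom_def)
    have the_\<alpha>: "the (\<alpha> n) = g n" if "n \<in> dom \<alpha>" for n
      using that unfolding dom by (simp add: \<alpha>_def)
    have "y \<in> V" if y: "y \<in> topspace (total prd)" "proj prd \<alpha> y = proj prd \<alpha> x" for y
    proof -
      have "y n \<in> U n" if "n \<in> I" for n
      proof (cases "n \<in> dom \<alpha>")
        case True
        then have "proj (Y n) (g n) (y n) = proj (Y n) (g n) (x n)"
          using y(2) the_\<alpha> unfolding proj_prd_eq_iff by metis
        moreover have "y n \<in> topspace (total (Y n))"
          using y(1) that unfolding topspace_prd PiE_iff by blast
        ultimately show ?thesis
          using g(2)[OF that] by blast
      next
        case False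
        then show ?thesis
          using dom that y(1) unfolding topspace_prd PiE_iff by blast
      qed
      then have "y \<in> Pi\<^sub>E I U"
        using y(1) unfolding topspace_prd PiE_iff by blast
      then show ?thesis
        using U(4) by blast
    qed
    moreover have "\<alpha> \<in> index prd"
      unfolding index_prd using U(1) g(1) dom the_\<alpha> by auto
    ultimately show ?thesis
      by blast
  qed
qed

text \<open>Above the singleton family \<open>[n \<mapsto> \<alpha>]\<close> every index has an
  entry at \<open>n\<close>, and it is at least \<alpha>; the unspecified value of
  \<open>the (\<beta> n)\<close> elsewhere does no harm. This transports limits from a factor to the
  net of the product.\<close>

lemma filterlim_component:
  assumes n: "n \<in> I"
  shows "filterlim (\<lambda>\<beta>. the (\<beta> n)) (tails (Y n)) (tails prd)"
  unfolding filterlim_iff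
proof (intro allI impI)
  fix Q
  assume "eventually Q (tails (Y n))"
  then obtain \<alpha> where \<alpha>: "\<alpha> \<in> index (Y n)" "\<And>\<beta>. \<beta> \<in> index (Y n) \<Longrightarrow> leq (Y n) \<alpha> \<beta> \<Longrightarrow> Q \<beta>"
    unfolding profinite_tower.eventually_tails[OF tower[OF n]] by blast
  then show "eventually (\<lambda>\<beta>. Q (the (\<beta> n))) (tails prd)"
    unfolding prd.eventually_tails using n
    by (intro bexI[of _ "[n \<mapsto> \<alpha>]"]) (auto simp: index_prd leq_prd)
qed

end

section \<open>Distributions and the weak-* topology\<close>

text \<open>The open sets are the traces on \<open>A\<close> of preimages under \<open>g\<close>; as
  the space is \<open>A\<close> itself, the net must eventually lie in it.\<close>

lemma limitin_pullback_topology: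
  "limitin (pullback_topology A g T) f l F \<longleftrightarrow>
    l \<in> A \<and> eventually (\<lambda>x. f x \<in> A) F \<and> limitin T (g \<circ> f) (g l) F"
proof
  assume lim: "limitin (pullback_topology A g T) f l F"
  then have l: "l \<in> A" "g l \<in> topspace T"
    unfolding limitin_def topspace_pullback_topology by blast+
  have ev: "eventually (\<lambda>x. f x \<in> g -` W \<inter> A) F" if "openin T W" "g l \<in> W" for W
    using lim that l unfolding limitin_def openin_pullback_topology by blast
  have "eventually (\<lambda>x. f x \<in> A) F"
    using ev[OF openin_topspace l(2)] by (rule eventually_mono) blast
  moreover have "limitin T (g \<circ> f) (g l) F"
    unfolding limitin_def
  proof (intro conjI allI impI)
    fix W
    assume "openin T W \<and> g l \<in> W"
    then have "eventually (\<lambda>x. f x \<in> g -` W \<inter> A) F"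
      using ev by blast
    then show "eventually (\<lambda>x. (g \<circ> f) x \<in> W) F"
      by (rule eventually_mono) simp
  qed (rule l)
  ultimately show "l \<in> A \<and> eventually (\<lambda>x. f x \<in> A) F \<and> limitin T (g \<circ> f) (g l) F"
    using l by blast
next
  assume R: "l \<in> A \<and> eventually (\<lambda>x. f x \<in> A) F \<and> limitin T (g \<circ> f) (g l) F"
  show "limitin (pullback_topology A g T) f l F"
    unfolding limitin_def topspace_pullback_topology
  proof (intro conjI allI impI)
    show "l \<in> g -` topspace T \<inter> A"
      using R unfolding limitin_def by blast
    fix V
    assume V: "openin (pullback_topology A g T) V \<and> l \<in> V"
    then obtain W where W: "openin T W" "V = g -` W \<inter> A"
      unfolding openin_pullback_topology by blast
    then have "eventually (\<lambda>x. (g \<circ> f) x \<in> W) F"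
      using R V unfolding limitin_def by blast
    with R have "eventually (\<lambda>x. (g \<circ> f) x \<in> W \<and> f x \<in> A) F"
      by (simp add: eventually_conj_iff)
    then show "eventually (\<lambda>x. f x \<in> V) F"
      by (rule eventually_mono) (simp add: W)
  qed
qed

lemma limitin_weak_star:
  "limitin (weak_star X) f \<mu> F \<longleftrightarrow> \<mu> \<in> distributions X \<and> eventually (\<lambda>x. f x \<in> distributions X) F \<and>
    (\<forall>U. compact_open X U \<longrightarrow> ((\<lambda>x. f x (indicator U)) \<longlongrightarrow> \<mu> (indicator U)) F)"
  unfolding weak_star_def limitin_pullback_topology limitin_componentwise
  by (simp add: comp_def)

lemma locally_constantD:
  "f \<in> locally_constant X \<Longrightarrow> x \<in> topspace X \<Longrightarrow> \<exists>V. openin X V \<and> x \<in> V \<and> (\<forall>y\<in>V. f y = f x)"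
  unfolding locally_constant_def by simp

text \<open>The condition \<open>h 0 0 = 0\<close> preserves the extension by zero outside the
  space.\<close>

lemma locally_constant_binop:
  assumes f: "f \<in> locally_constant X" and g: "g \<in> locally_constant X" and "h 0 0 = 0"
  shows "(\<lambda>x. h (f x) (g x)) \<in> locally_constant X"
  unfolding locally_constant_def mem_Collect_eq
proof (intro conjI allI impI ballI)
  show "h (f x) (g x) = 0" if "x \<notin> topspace X" for x
    using f g that assms(3) unfolding locally_constant_def by simp
  fix x
  assume x: "x \<in> topspace X"
  obtain V where V: "openin X V" "x \<in> V" "\<forall>y\<in>V. f y = f x"
    using locally_constantD[OF f x] by blast
  obtain W where W: "openin X W" "x \<in> W" "\<forall>y\<in>W. g y = g x"
    using locally_constantD[OF g x] by blast
  have "h (f y) (g y) = h (f x) (g x)" if "y \<in> V \<inter> W" for y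
    using bspec[OF V(3), of y] bspec[OF W(3), of y] that by simp
  then show "\<exists>V. openin X V \<and> x \<in> V \<and> (\<forall>y\<in>V. h (f y) (g y) = h (f x) (g x))"
    using V(1,2) W(1,2) by (intro exI[of _ "V \<inter> W"] conjI openin_Int ballI) blast+
qed

lemma locally_constant_add:
  fixes f g :: "'a \<Rightarrow> 'r::comm_ring_1"
  shows "f \<in> locally_constant X \<Longrightarrow> g \<in> locally_constant X \<Longrightarrow> (\<lambda>x. f x + g x) \<in> locally_constant X"
  by (rule locally_constant_binop) simp_all

lemma locally_constant_mult:
  fixes f g :: "'a \<Rightarrow> 'r::comm_ring_1"
  shows "f \<in> locally_constant X \<Longrightarrow> g \<in> locally_constant X \<Longrightarrow> (\<lambda>x. f x * g x) \<in> locally_constant X"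
  by (rule locally_constant_binop) simp_all

lemma locally_constant_scale:
  fixes f :: "'a \<Rightarrow> 'r::comm_ring_1"
  shows "f \<in> locally_constant X \<Longrightarrow> (\<lambda>x. c * f x) \<in> locally_constant X"
  by (rule locally_constant_binop[where g = f and h = "\<lambda>a b. c * a"]) simp_all

lemma locally_constant_0: "(\<lambda>x. 0) \<in> locally_constant X"
  unfolding locally_constant_def by blast

lemma locally_constant_sum:
  fixes f :: "'i \<Rightarrow> 'a \<Rightarrow> 'r::comm_ring_1"
  shows "(\<And>i. i \<in> A \<Longrightarrow> f i \<in> locally_constant X) \<Longrightarrow> (\<lambda>x. \<Sum>i\<in>A. f i x) \<in> locally_constant X"
  by (induction A rule: infinite_finite_induct) (simp_all add: locally_constant_0 locally_constant_add)

lemma distributionsI: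
  fixes \<mu> :: "('a \<Rightarrow> 'r::comm_ring_1) \<Rightarrow> 'r"
  assumes "\<mu> \<in> extensional (locally_constant X)"
    and "\<And>f g. f \<in> locally_constant X \<Longrightarrow> g \<in> locally_constant X \<Longrightarrow> \<mu> (\<lambda>x. f x + g x) = \<mu> f + \<mu> g"
    and "\<And>c f. f \<in> locally_constant X \<Longrightarrow> \<mu> (\<lambda>x. c * f x) = c * \<mu> f"
  shows "\<mu> \<in> distributions X"
  unfolding distributions_def using assms by simp

lemma distributions_add:
  "\<mu> \<in> distributions X \<Longrightarrow> f \<in> locally_constant X \<Longrightarrow> g \<in> locally_constant X
    \<Longrightarrow> \<mu> (\<lambda>x. f x + g x) = \<mu> f + \<mu> g"
  unfolding distributions_def by simp

lemma distributions_scale: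
  "\<mu> \<in> distributions X \<Longrightarrow> f \<in> locally_constant X \<Longrightarrow> \<mu> (\<lambda>x. c * f x) = c * \<mu> f"
  unfolding distributions_def by simp

lemma distributions_0: "\<mu> \<in> distributions X \<Longrightarrow> \<mu> (\<lambda>x. 0) = 0"
  using distributions_scale[OF _ locally_constant_0, of \<mu> X 0] by simp

lemma distributions_sum:
  "\<mu> \<in> distributions X \<Longrightarrow> (\<And>i. i \<in> A \<Longrightarrow> f i \<in> locally_constant X)
    \<Longrightarrow> \<mu> (\<lambda>x. \<Sum>i\<in>A. f i x) = (\<Sum>i\<in>A. \<mu> (f i))"
proof (induction A rule: infinite_finite_induct)
  case (insert j A)
  then have "\<mu> (\<lambda>x. f j x + (\<Sum>i\<in>A. f i x)) = \<mu> (f j) + \<mu> (\<lambda>x. \<Sum>i\<in>A. f i x)"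
    by (intro distributions_add locally_constant_sum) blast+
  with insert show ?case
    by simp
qed (simp_all add: distributions_0)

lemma zero_distributions: "(\<lambda>f\<in>locally_constant X. 0) \<in> distributions X"
  by (rule distributionsI) (simp_all add: locally_constant_add locally_constant_scale)

lemma times_dist_distributions:
  assumes "\<mu> \<in> distributions X" "f \<in> locally_constant X"
  shows "times_dist X f \<mu> \<in> distributions X"
proof (rule distributionsI)
  fix g h :: "'a \<Rightarrow> 'b"
  assume *: "g \<in> locally_constant X" "h \<in> locally_constant X"
  have "\<mu> (\<lambda>x. f x * (g x + h x)) = \<mu> (\<lambda>x. f x * g x + f x * h x)"
    by (simp add: distrib_left)
  also have "\<dots> = \<mu> (\<lambda>x. f x * g x) + \<mu> (\<lambda>x. f x * h x)"
    using distributions_add[OF assms(1) locally_constant_mult[OF assms(2) *(1)]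
        locally_constant_mult[OF assms(2) *(2)]] .
  finally show "times_dist X f \<mu> (\<lambda>x. g x + h x) = times_dist X f \<mu> g + times_dist X f \<mu> h"
    using * by (simp add: times_dist_def locally_constant_add)
next
  fix c and g :: "'a \<Rightarrow> 'b"
  assume *: "g \<in> locally_constant X"
  have "\<mu> (\<lambda>x. f x * (c * g x)) = \<mu> (\<lambda>x. c * (f x * g x))"
    by (simp add: mult.left_commute)
  also have "\<dots> = c * \<mu> (\<lambda>x. f x * g x)"
    using distributions_scale[OF assms(1) locally_constant_mult[OF assms(2) *]] .
  finally show "times_dist X f \<mu> (\<lambda>x. c * g x) = c * times_dist X f \<mu> g"
    using * by (simp add: times_dist_def locally_constant_scale)
qed (simp add: times_dist_def)

lemma scale_dist_distributions:
  assumes "\<mu> \<in> distributions X"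
  shows "scale_dist X c \<mu> \<in> distributions X"
  using assms
  by (intro distributionsI)
    (simp_all add: scale_dist_def locally_constant_add locally_constant_scale distributions_add
      distributions_scale distrib_left mult.left_commute)

section \<open>Procounting distributions on a tower\<close>

context profinite_tower
begin

lemma sum_level_indicator:
  assumes "\<alpha> \<in> index P" "A \<subseteq> level P \<alpha>"
  shows "(\<Sum>a\<in>level P \<alpha>. indicator A a) = (of_nat (card A) :: 'r::comm_ring_1)"
  using assms finite_level[of \<alpha>] by (simp add: indicator_def Int_absorb1 sum.If_cases of_bool_def)

lemma procounting_whole_eval:
  fixes \<mu> :: "('a \<Rightarrow> 'r::Q_algebra) \<Rightarrow> 'r"
  assumes \<mu>: "procounting_whole P \<mu>" and \<alpha>: "\<alpha> \<in> index P"
  shows "\<mu> (\<lambda>x. if x \<in> topspace (total P) then g (proj P \<alpha> x) else 0)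
    = of_Q (1 / of_nat (card (level P \<alpha>))) * (\<Sum>a\<in>level P \<alpha>. g a)"
proof -
  let ?D = "discrete_topology (level P \<alpha>)"
  \<comment> \<open>Members of \<open>locally_constant\<close> vanish outside the space, so
    \<open>g\<close> is cut off outside the level; projected points do not notice.\<close>
  define g' where "g' = (\<lambda>a. if a \<in> level P \<alpha> then g a else 0)"
  have g': "g' \<in> locally_constant ?D"
    unfolding locally_constant_def mem_Collect_eq
  proof (intro conjI allI impI ballI)
    show "\<exists>V. openin ?D V \<and> a \<in> V \<and> (\<forall>y\<in>V. g' y = g' a)" if "a \<in> topspace ?D" for a
      using that by (intro exI[of _ "{a}"]) simp
  qed (simp add: g'_def)
  have "push_forward (total P) ?D (proj P \<alpha>) \<mu> g' = uniform_dist (level P \<alpha>) g'"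
    using \<mu> \<alpha> unfolding procounting_whole_def by simp
  moreover have "uniform_dist (level P \<alpha>) g'
      = of_Q (1 / of_nat (card (level P \<alpha>))) * (\<Sum>a\<in>level P \<alpha>. g a)"
    unfolding uniform_dist_def scale_dist_def using g' by (simp add: dirac_def) (simp add: g'_def)
  moreover have "push_forward (total P) ?D (proj P \<alpha>) \<mu> g'
      = \<mu> (\<lambda>x. if x \<in> topspace (total P) then g (proj P \<alpha> x) else 0)"
    unfolding push_forward_def using g' proj_in_level[OF \<alpha>]
    by (simp add: g'_def cong: if_cong)
  ultimately show ?thesis
    by simp
qed

text \<open>A union of fibres is the preimage of its image.\<close>

lemma indicator_factors_eq:
  assumes "factors \<alpha> (\<lambda>x. x \<in> U)" "U \<subseteq> topspace (total P)"
  shows "indicator U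
    = (\<lambda>x. if x \<in> topspace (total P) then indicator (proj P \<alpha> ` U) (proj P \<alpha> x) else 0)"
proof
  fix x
  have "proj P \<alpha> x \<in> proj P \<alpha> ` U \<longleftrightarrow> x \<in> U" if "x \<in> topspace (total P)"
    using assms that factorsD[OF assms(1)] by blast
  then show "indicator U x
      = (if x \<in> topspace (total P) then indicator (proj P \<alpha> ` U) (proj P \<alpha> x) else 0)"
    using assms(2) by (cases "x \<in> topspace (total P)") (auto simp: indicator_def)
qed

lemma procounting_whole_indicator:
  fixes \<mu> :: "('a \<Rightarrow> 'r::Q_algebra) \<Rightarrow> 'r"
  assumes \<mu>: "procounting_whole P \<mu>" and \<alpha>: "\<alpha> \<in> index P"
    and U: "factors \<alpha> (\<lambda>x. x \<in> U)" "U \<subseteq> topspace (total P)"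
  shows "\<mu> (indicator U) = of_Q (of_nat (card (proj P \<alpha> ` U)) / of_nat (card (level P \<alpha>)))"
proof -
  have "proj P \<alpha> ` U \<subseteq> level P \<alpha>"
    using U(2) proj_in_level[OF \<alpha>] by blast
  then have "(\<Sum>a\<in>level P \<alpha>. indicator (proj P \<alpha> ` U) a) = (of_Q (of_nat (card (proj P \<alpha> ` U))) :: 'r)"
    unfolding of_Q_of_nat by (rule sum_level_indicator[OF \<alpha>])
  then show ?thesis
    unfolding indicator_factors_eq[OF U] procounting_whole_eval[OF \<mu> \<alpha>]
    by (simp flip: of_Q_mult)
qed

section \<open>Equal fibre cardinalities and the distribution of the whole space\<close>

definition fibre :: "'j \<Rightarrow> 'b \<Rightarrow> 'a set" where
  "fibre \<alpha> a = {x \<in> topspace (total P). proj P \<alpha> x = a}"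

lemma fibre_subset: "fibre \<alpha> a \<subseteq> topspace (total P)"
  unfolding fibre_def by blast

lemma factors_fibre: "factors \<alpha> (\<lambda>x. x \<in> fibre \<alpha> a)"
  unfolding factors_def fibre_def by simp

lemma proj_fibre: "\<alpha> \<in> index P \<Longrightarrow> a \<in> level P \<alpha> \<Longrightarrow> proj P \<alpha> ` fibre \<alpha> a = {a}"
  unfolding fibre_def proj_image[symmetric] by blast

text \<open>The image of \<open>fibre \<alpha> a\<close> in level \<beta> is the fibre over
  \<open>a\<close> of the transition map, described without that map. The product form avoids
  division of natural numbers.\<close>

definition equidistributed :: bool where
  "equidistributed \<longleftrightarrow> (\<forall>\<alpha>\<in>index P. \<forall>\<beta>\<in>index P. leq P \<alpha> \<beta> \<longrightarrow>
    (\<forall>a\<in>level P \<alpha>. card (proj P \<beta> ` fibre \<alpha> a) * card (level P \<alpha>) = card (level P \<beta>)))"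

text \<open>The mass of \<open>fibre \<alpha> a\<close> can be computed at level \<alpha>, where it
  is one point, and at level \<beta>. Injectivity of \<open>of_Q\<close> turns the two answers into
  an equation of cardinalities.\<close>

lemma procounting_whole_imp_equidistributed:
  fixes \<mu> :: "('a \<Rightarrow> 'r::Q_algebra) \<Rightarrow> 'r"
  assumes \<mu>: "procounting_whole P \<mu>"
  shows equidistributed
  unfolding equidistributed_def
proof (intro ballI impI)
  fix \<alpha> \<beta> a
  assume *: "\<alpha> \<in> index P" "\<beta> \<in> index P" "leq P \<alpha> \<beta>" "a \<in> level P \<alpha>"
  have "of_Q (of_nat (card (proj P \<beta> ` fibre \<alpha> a)) / of_nat (card (level P \<beta>)))
      = \<mu> (indicator (fibre \<alpha> a))"
    using procounting_whole_indicator[OF \<mu> *(2) factors_leq[OF factors_fibre *(1-3)] fibre_subset] ..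
  also have "\<dots> = of_Q (1 / of_nat (card (level P \<alpha>)))"
    using procounting_whole_indicator[OF \<mu> *(1) factors_fibre fibre_subset, of a]
    by (simp add: proj_fibre *)
  finally have "of_nat (card (proj P \<beta> ` fibre \<alpha> a)) / of_nat (card (level P \<beta>))
      = (1 / of_nat (card (level P \<alpha>)) :: rat)"
    by (simp only: of_Q_eq_iff)
  then have "(of_nat (card (proj P \<beta> ` fibre \<alpha> a) * card (level P \<alpha>)) :: rat) = of_nat (card (level P \<beta>))"
    using card_level_pos[OF *(1)] card_level_pos[OF *(2)] by (simp add: field_simps)
  then show "card (proj P \<beta> ` fibre \<alpha> a) * card (level P \<alpha>) = card (level P \<beta>)"
    by (simp only: of_nat_eq_iff)
qed

text \<open>An arbitrary representative of the fibre, through which functions on the space are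
  evaluated at points of a level.\<close>

definition section_at :: "'j \<Rightarrow> 'b \<Rightarrow> 'a" where
  "section_at \<alpha> a = (SOME x. x \<in> fibre \<alpha> a)"

lemma section_at:
  assumes "\<alpha> \<in> index P" "a \<in> level P \<alpha>"
  shows "section_at \<alpha> a \<in> topspace (total P)" "proj P \<alpha> (section_at \<alpha> a) = a"
proof -
  have "\<exists>x. x \<in> fibre \<alpha> a"
    using assms unfolding proj_image[OF assms(1), symmetric] fibre_def by blast
  then have "section_at \<alpha> a \<in> fibre \<alpha> a"
    unfolding section_at_def by (rule someI_ex)
  then show "section_at \<alpha> a \<in> topspace (total P)" "proj P \<alpha> (section_at \<alpha> a) = a"
    unfolding fibre_def by blast+
qed

text \<open>The integral of \<open>f\<close> against the future distribution of the whole space. It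
  does not depend on the chosen representatives when \<open>f\<close> factors through level
  \<alpha>.\<close>

definition average :: "'j \<Rightarrow> ('a \<Rightarrow> 'r::Q_algebra) \<Rightarrow> 'r" where
  "average \<alpha> f = of_Q (1 / of_nat (card (level P \<alpha>))) * (\<Sum>a\<in>level P \<alpha>. f (section_at \<alpha> a))"

text \<open>The points of level \<beta> are grouped by their image \<open>?h b\<close> in level
  \<alpha>, where \<open>?h\<close> replaces the transition map. On each group \<open>f\<close> is
  constant, and all groups have the same size.\<close>

lemma average_leq:
  fixes f :: "'a \<Rightarrow> 'r::Q_algebra"
  assumes equi: equidistributed and \<alpha>: "\<alpha> \<in> index P" and \<beta>: "\<beta> \<in> index P" and leq: "leq P \<alpha> \<beta>"
    and f: "factors \<alpha> f"
  shows "average \<beta> f = average \<alpha> f"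
proof -
  let ?h = "\<lambda>b. proj P \<alpha> (section_at \<beta> b)"
  have fib: "{b \<in> level P \<beta>. ?h b = a} = proj P \<beta> ` fibre \<alpha> a" for a
  proof
    show "{b \<in> level P \<beta>. ?h b = a} \<subseteq> proj P \<beta> ` fibre \<alpha> a"
      using section_at[OF \<beta>] unfolding fibre_def by force
    show "proj P \<beta> ` fibre \<alpha> a \<subseteq> {b \<in> level P \<beta>. ?h b = a}"
    proof
      fix b
      assume "b \<in> proj P \<beta> ` fibre \<alpha> a"
      then obtain x where x: "x \<in> topspace (total P)" "proj P \<alpha> x = a" "b = proj P \<beta> x"
        unfolding fibre_def by blast
      then have b: "b \<in> level P \<beta>"
        using proj_in_level[OF \<beta>] by blast
      then have "proj P \<alpha> (section_at \<beta> b) = proj P \<alpha> x"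
        using section_at[OF \<beta> b] x by (intro proj_leq[OF \<alpha> \<beta> leq]) simp_all
      then show "b \<in> {b \<in> level P \<beta>. ?h b = a}"
        using b x by blast
    qed
  qed
  have "(\<Sum>b\<in>level P \<beta>. f (section_at \<beta> b))
      = (\<Sum>a\<in>level P \<alpha>. \<Sum>b\<in>{b \<in> level P \<beta>. ?h b = a}. f (section_at \<beta> b))"
    using section_at(1)[OF \<beta>] proj_in_level[OF \<alpha>]
    by (intro sum.group[symmetric] finite_level \<alpha> \<beta>) blast
  also have "\<dots> = (\<Sum>a\<in>level P \<alpha>. of_nat (card (proj P \<beta> ` fibre \<alpha> a)) * f (section_at \<alpha> a))"
  proof (rule sum.cong[OF refl])
    fix a
    assume a: "a \<in> level P \<alpha>"
    have "f (section_at \<beta> b) = f (section_at \<alpha> a)" if "b \<in> level P \<beta>" "?h b = a" for b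
      using that section_at[OF \<beta> that(1)] section_at[OF \<alpha> a] by (intro factorsD[OF f]) simp_all
    then have "(\<Sum>b\<in>{b \<in> level P \<beta>. ?h b = a}. f (section_at \<beta> b))
        = (\<Sum>b\<in>{b \<in> level P \<beta>. ?h b = a}. f (section_at \<alpha> a))"
      by (intro sum.cong) simp_all
    then show "(\<Sum>b\<in>{b \<in> level P \<beta>. ?h b = a}. f (section_at \<beta> b))
        = of_nat (card (proj P \<beta> ` fibre \<alpha> a)) * f (section_at \<alpha> a)"
      by (simp add: fib)
  qed
  also have "\<dots> = (\<Sum>a\<in>level P \<alpha>. of_Q (of_nat (card (level P \<beta>)) / of_nat (card (level P \<alpha>)))
      * f (section_at \<alpha> a))"
  proof (rule sum.cong[OF refl])
    fix a
    assume "a \<in> level P \<alpha>"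
    then have "card (proj P \<beta> ` fibre \<alpha> a) * card (level P \<alpha>) = card (level P \<beta>)"
      using equi \<alpha> \<beta> leq unfolding equidistributed_def by blast
    then have "(of_nat (card (proj P \<beta> ` fibre \<alpha> a)) * of_nat (card (level P \<alpha>)) :: rat)
        = of_nat (card (level P \<beta>))"
      by (metis of_nat_mult)
    then have "(of_nat (card (level P \<beta>)) / of_nat (card (level P \<alpha>)) :: rat)
        = of_nat (card (proj P \<beta> ` fibre \<alpha> a))"
      using card_level_pos[OF \<alpha>] by (simp add: divide_eq_eq)
    then show "of_nat (card (proj P \<beta> ` fibre \<alpha> a)) * f (section_at \<alpha> a)
        = of_Q (of_nat (card (level P \<beta>)) / of_nat (card (level P \<alpha>))) * f (section_at \<alpha> a)"
      by (simp add: of_Q_of_nat)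
  qed
  finally show ?thesis
    using card_level_pos[OF \<beta>]
    by (simp add: average_def flip: sum_distrib_left mult.assoc of_Q_mult)
qed

lemma average_cong_level:
  assumes equi: equidistributed and \<alpha>: "\<alpha> \<in> index P" and \<beta>: "\<beta> \<in> index P"
    and f: "factors \<alpha> f" "factors \<beta> f"
  shows "average \<alpha> f = average \<beta> f"
proof -
  obtain \<gamma> where \<gamma>: "\<gamma> \<in> index P" "leq P \<alpha> \<gamma>" "leq P \<beta> \<gamma>"
    using directed[OF \<alpha> \<beta>] by blast
  show ?thesis
    using average_leq[OF equi \<alpha> \<gamma>(1,2) f(1)] average_leq[OF equi \<beta> \<gamma>(1,3) f(2)] by simp
qed

text \<open>The value at \<open>f\<close> is its average at any level through which it factors;
  \<open>average_cong_level\<close> makes the choice immaterial, so additivity can be checked at a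
  common level.\<close>

lemma ex_procounting_whole:
  assumes equi: equidistributed
  shows "\<exists>\<mu> :: ('a \<Rightarrow> 'r::Q_algebra) \<Rightarrow> 'r. procounting_whole P \<mu>"
proof -
  let ?L = "locally_constant (total P) :: ('a \<Rightarrow> 'r) set"
  define lev where "lev = (\<lambda>f :: 'a \<Rightarrow> 'r. SOME \<alpha>. \<alpha> \<in> index P \<and> factors \<alpha> f)"
  define \<mu> where "\<mu> = (\<lambda>f\<in>?L. average (lev f) f)"
  have lev: "lev f \<in> index P \<and> factors (lev f) f" if "f \<in> ?L" for f
    unfolding lev_def by (rule someI_ex) (use locally_constant_factors[OF that] in blast)
  have \<mu>: "\<mu> f = average \<alpha> f" if "f \<in> ?L" "\<alpha> \<in> index P" "factors \<alpha> f" for f \<alpha>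
  proof -
    have "average (lev f) f = average \<alpha> f"
      using lev[OF that(1)] that(2,3) by (intro average_cong_level[OF equi]) blast+
    then show ?thesis
      using that(1) by (simp add: \<mu>_def)
  qed
  have "\<mu> \<in> distributions (total P)"
  proof (rule distributionsI)
    show "\<mu> \<in> extensional ?L"
      by (simp add: \<mu>_def)
    show "\<mu> (\<lambda>x. f x + g x) = \<mu> f + \<mu> g" if fg: "f \<in> ?L" "g \<in> ?L" for f g
    proof -
      obtain \<gamma> where \<gamma>: "\<gamma> \<in> index P" "leq P (lev f) \<gamma>" "leq P (lev g) \<gamma>"
        using directed lev fg by blast
      then have "factors \<gamma> f" "factors \<gamma> g"
        using lev fg factors_leq by blast+
      moreover from this have "factors \<gamma> (\<lambda>x. f x + g x)"
        unfolding factors_def by metis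
      ultimately show ?thesis
        using fg \<gamma>(1) locally_constant_add[OF fg]
        by (simp add: \<mu> average_def sum.distrib distrib_left)
    qed
    show "\<mu> (\<lambda>x. c * f x) = c * \<mu> f" if f: "f \<in> ?L" for c f
    proof -
      have "factors (lev f) (\<lambda>x. c * f x)"
        using lev[OF f] unfolding factors_def by metis
      then have "\<mu> (\<lambda>x. c * f x) = average (lev f) (\<lambda>x. c * f x)"
        using lev[OF f] locally_constant_scale[OF f] by (intro \<mu>) blast+
      also have "\<dots> = c * average (lev f) f"
        by (simp add: average_def mult.left_commute flip: sum_distrib_left)
      also have "average (lev f) f = \<mu> f"
        using f by (simp add: \<mu>_def)
      finally show ?thesis .
    qed
  qed
  moreover have "push_forward (total P) (discrete_topology (level P \<alpha>)) (proj P \<alpha>) \<mu>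
      = uniform_dist (level P \<alpha>)" if \<alpha>: "\<alpha> \<in> index P" for \<alpha>
  proof
    fix g :: "'b \<Rightarrow> 'r"
    let ?g = "\<lambda>x. if x \<in> topspace (total P) then g (proj P \<alpha> x) else 0"
    show "push_forward (total P) (discrete_topology (level P \<alpha>)) (proj P \<alpha>) \<mu> g
        = uniform_dist (level P \<alpha>) g"
    \<comment> \<open>Both sides are extensional, so only a locally constant \<open>g\<close> needs
      a computation.\<close>
    proof (cases "g \<in> locally_constant (discrete_topology (level P \<alpha>))")
      case True
      have fact: "factors \<alpha> ?g"
        unfolding factors_def by simp
      then have "?g \<in> ?L"
        by (intro factors_locally_constant[OF \<alpha>]) simp_all
      then have "\<mu> ?g = average \<alpha> ?g"
        using \<alpha> fact by (rule \<mu>)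
      also have "\<dots> = of_Q (1 / of_nat (card (level P \<alpha>))) * (\<Sum>a\<in>level P \<alpha>. g a)"
        unfolding average_def using section_at[OF \<alpha>] by simp
      finally show ?thesis
        using True by (simp add: push_forward_def uniform_dist_def scale_dist_def dirac_def)
    next
      case False
      then show ?thesis
        by (simp add: push_forward_def uniform_dist_def scale_dist_def)
    qed
  qed
  ultimately show ?thesis
    unfolding procounting_whole_def by blast
qed

text \<open>Kept in \<open>rat\<close>, so that quotients and products over coordinates are computed
  in a field before \<open>of_Q\<close> is applied.\<close>

definition frequency :: "'a set \<Rightarrow> 'a set \<Rightarrow> 'j \<Rightarrow> rat" where
  "frequency S U \<beta> = of_nat (card (proj P \<beta> ` U \<inter> proj P \<beta> ` S)) / of_nat (card (proj P \<beta> ` S))"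

lemma approx_dist_distributions:
  fixes \<mu> :: "('a \<Rightarrow> 'r::Q_algebra) \<Rightarrow> 'r"
  assumes "\<mu> \<in> distributions (total P)" and \<beta>: "\<beta> \<in> index P"
  shows "approx_dist P \<mu> S \<beta> \<in> distributions (total P)"
proof -
  have "compact_open (total P) {x \<in> topspace (total P). proj P \<beta> x \<in> proj P \<beta> ` S}"
    by (rule compact_open_saturated[OF \<beta>]) (auto simp: factors_def)
  from indicator_locally_constant[OF this, where 'c = 'r] assms(1) show ?thesis
    unfolding approx_dist_def
    by (simp add: zero_distributions scale_dist_distributions times_dist_distributions)
qed

text \<open>The factor \<open>card (level P \<beta>)\<close> of the approximation cancels the
  normalization of the distribution of the whole space.\<close>

lemma approx_dist_indicator:
  fixes \<mu> :: "('a \<Rightarrow> 'r::Q_algebra) \<Rightarrow> 'r"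
  assumes \<mu>: "procounting_whole P \<mu>" and \<beta>: "\<beta> \<in> index P" and S: "S \<noteq> {}"
    and U: "factors \<beta> (\<lambda>x. x \<in> U)" "U \<subseteq> topspace (total P)"
  shows "approx_dist P \<mu> S \<beta> (indicator U) = of_Q (frequency S U \<beta>)"
proof -
  let ?W = "{x \<in> topspace (total P). proj P \<beta> x \<in> proj P \<beta> ` S}"
  have co: "compact_open (total P) U"
    using \<beta> U by (rule compact_open_saturated)
  have "factors \<beta> (\<lambda>x. x \<in> ?W \<inter> U)"
    unfolding factors_def
  proof (intro ballI impI)
    fix x y
    assume *: "x \<in> topspace (total P)" "y \<in> topspace (total P)" "proj P \<beta> x = proj P \<beta> y"
    show "x \<in> ?W \<inter> U \<longleftrightarrow> y \<in> ?W \<inter> U"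
      using factorsD[OF U(1) *] * by simp
  qed
  moreover have "?W \<inter> U \<subseteq> topspace (total P)"
    using U(2) by blast
  ultimately have "\<mu> (indicator (?W \<inter> U))
      = of_Q (of_nat (card (proj P \<beta> ` (?W \<inter> U))) / of_nat (card (level P \<beta>)))"
    by (rule procounting_whole_indicator[OF \<mu> \<beta>])
  moreover have "proj P \<beta> ` (?W \<inter> U) = proj P \<beta> ` U \<inter> proj P \<beta> ` S"
    using U(2) by blast
  moreover have "indicator (?W \<inter> U) = (\<lambda>x. indicator ?W x * indicator U x :: 'r)"
    by (rule ext) (rule indicator_inter_arith)
  ultimately have "approx_dist P \<mu> S \<beta> (indicator U)
      = of_Q (of_nat (card (level P \<beta>)) / of_nat (card (proj P \<beta> ` S)))
        * of_Q (of_nat (card (proj P \<beta> ` U \<inter> proj P \<beta> ` S)) / of_nat (card (level P \<beta>)))"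
    using S indicator_locally_constant[OF co, where 'c = 'r]
    by (simp add: approx_dist_def scale_dist_def times_dist_def)
  then show ?thesis
    using card_level_pos[OF \<beta>] by (simp add: frequency_def flip: of_Q_mult)
qed

lemma eventually_approx_dist_indicator:
  fixes \<mu> :: "('a \<Rightarrow> 'r::Q_algebra) \<Rightarrow> 'r"
  assumes \<mu>: "procounting_whole P \<mu>" and S: "S \<noteq> {}" and U: "compact_open (total P) U"
  shows "eventually (\<lambda>\<beta>. approx_dist P \<mu> S \<beta> (indicator U) = of_Q (frequency S U \<beta>)) (tails P)"
proof -
  obtain \<alpha> where \<alpha>: "\<alpha> \<in> index P" "factors \<alpha> (\<lambda>x. x \<in> U)"
    using compact_open_factors[OF U] by blast
  moreover have "U \<subseteq> topspace (total P)"
    using U by (simp add: compact_open_def compactin_subset_topspace)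
  ultimately show ?thesis
    unfolding eventually_tails
    by (intro bexI[OF _ \<alpha>(1)] ballI impI approx_dist_indicator[OF \<mu> _ S] factors_leq[OF \<alpha>(2,1)])
qed

lemma eventually_index: "eventually (\<lambda>\<beta>. \<beta> \<in> index P) (tails P)"
  unfolding eventually_tails using index_nonempty by blast

lemma procounting_distributions: "procounting P S \<mu> \<Longrightarrow> \<mu> \<in> distributions (total P)"
  unfolding procounting_def limitin_weak_star by blast

text \<open>The distribution of the whole space is only known to exist here; it disappears because
  the approximations eventually take values given by cardinalities alone.\<close>

lemma procounting_imp_tendsto:
  assumes "procounting P S \<mu>" "S \<noteq> {}" "compact_open (total P) U"
  shows "((\<lambda>\<beta>. of_Q (frequency S U \<beta>)) \<longlongrightarrow> \<mu> (indicator U)) (tails P)"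
proof -
  obtain \<mu>X where \<mu>X: "procounting_whole P \<mu>X"
    "((\<lambda>\<beta>. approx_dist P \<mu>X S \<beta> (indicator U)) \<longlongrightarrow> \<mu> (indicator U)) (tails P)"
    using assms(1,3) unfolding procounting_def limitin_weak_star by blast
  then show ?thesis
    unfolding tendsto_cong[OF eventually_approx_dist_indicator[OF \<mu>X(1) assms(2,3)]] by blast
qed

text \<open>Each point lies in exactly one fibre, on which \<open>f\<close> has its value at the
  representative.\<close>

lemma locally_constant_expansion:
  fixes f :: "'a \<Rightarrow> 'r::comm_ring_1"
  assumes \<alpha>: "\<alpha> \<in> index P" and f: "factors \<alpha> f" and "f \<in> locally_constant (total P)"
  shows "f = (\<lambda>x. \<Sum>a\<in>level P \<alpha>. f (section_at \<alpha> a) * indicator (fibre \<alpha> a) x)"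
proof
  fix x
  show "f x = (\<Sum>a\<in>level P \<alpha>. f (section_at \<alpha> a) * indicator (fibre \<alpha> a) x)"
  proof (cases "x \<in> topspace (total P)")
    case True
    then have a: "proj P \<alpha> x \<in> level P \<alpha>"
      using proj_in_level[OF \<alpha>] by blast
    have "(\<Sum>a\<in>level P \<alpha>. f (section_at \<alpha> a) * indicator (fibre \<alpha> a) x)
        = (\<Sum>a\<in>level P \<alpha>. if proj P \<alpha> x = a then f (section_at \<alpha> a) else 0)"
      using True by (intro sum.cong) (simp_all add: fibre_def indicator_def)
    also have "\<dots> = f (section_at \<alpha> (proj P \<alpha> x))"
      using a finite_level[OF \<alpha>] by simp
    also have "\<dots> = f x"
      using section_at[OF \<alpha> a] True by (intro factorsD[OF f])
    finally show ?thesis ..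
  next
    case False
    then have "f x = 0"
      using assms(3) unfolding locally_constant_def by blast
    then show ?thesis
      using False by (simp add: fibre_def)
  qed
qed

text \<open>Limits on the fibres are supplied as a hypothesis, and the expansion in fibres extends
  them to all locally constant functions. The pointwise limit is linear because limits are
  unique.\<close>

lemma ex_procounting:
  fixes v :: "'r::{Q_algebra,topological_space} \<Rightarrow> real"
  assumes v: "nontrivial_absolute_value v" and \<mu>X: "procounting_whole P (\<mu>X :: ('a \<Rightarrow> 'r) \<Rightarrow> 'r)"
    and S: "S \<noteq> {}"
    and lim: "\<And>\<alpha> a. \<alpha> \<in> index P \<Longrightarrow> a \<in> level P \<alpha> \<Longrightarrow>
      \<exists>l :: 'r. ((\<lambda>\<beta>. of_Q (frequency S (fibre \<alpha> a) \<beta>)) \<longlongrightarrow> l) (tails P)"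
  shows "\<exists>\<mu> :: ('a \<Rightarrow> 'r) \<Rightarrow> 'r. procounting P S \<mu>"
proof -
  interpret v: nontrivial_absolute_value v
    by (rule v)
  let ?L = "locally_constant (total P) :: ('a \<Rightarrow> 'r) set"
  let ?A = "approx_dist P \<mu>X S"
  have A: "eventually (\<lambda>\<beta>. ?A \<beta> \<in> distributions (total P)) (tails P)"
    using eventually_index
  proof (rule eventually_mono)
    show "?A \<beta> \<in> distributions (total P)" if "\<beta> \<in> index P" for \<beta>
      using \<mu>X that by (intro approx_dist_distributions) (simp_all add: procounting_whole_def)
  qed
  \<comment> \<open>Indicators would not be enough: the limit must be defined as a functional on all
    of \<open>locally_constant\<close>.\<close>
  have conv: "\<exists>l. ((\<lambda>\<beta>. ?A \<beta> f) \<longlongrightarrow> l) (tails P)" if f: "f \<in> ?L" for f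
  proof -
    obtain \<alpha> where \<alpha>: "\<alpha> \<in> index P" "factors \<alpha> f"
      using locally_constant_factors[OF f] by blast
    have co: "compact_open (total P) (fibre \<alpha> a)" for a
      by (rule compact_open_saturated[OF \<alpha>(1) factors_fibre fibre_subset])
    have "\<exists>l. ((\<lambda>\<beta>. ?A \<beta> (indicator (fibre \<alpha> a))) \<longlongrightarrow> l) (tails P)" if "a \<in> level P \<alpha>" for a
      unfolding tendsto_cong[OF eventually_approx_dist_indicator[OF \<mu>X S co]]
      by (rule lim[OF \<alpha>(1) that])
    then obtain l where l: "\<And>a. a \<in> level P \<alpha> \<Longrightarrow>
        ((\<lambda>\<beta>. ?A \<beta> (indicator (fibre \<alpha> a))) \<longlongrightarrow> l a) (tails P)"
      by metis
    have "((\<lambda>\<beta>. \<Sum>a\<in>level P \<alpha>. f (section_at \<alpha> a) * ?A \<beta> (indicator (fibre \<alpha> a)))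
        \<longlongrightarrow> (\<Sum>a\<in>level P \<alpha>. f (section_at \<alpha> a) * l a)) (tails P)"
      by (intro v.tendsto_sum_v v.tendsto_mult_v tendsto_const l)
    moreover have ev: "eventually (\<lambda>\<beta>. ?A \<beta> f
        = (\<Sum>a\<in>level P \<alpha>. f (section_at \<alpha> a) * ?A \<beta> (indicator (fibre \<alpha> a)))) (tails P)"
      using A
    proof (rule eventually_mono)
      fix \<beta>
      assume D: "?A \<beta> \<in> distributions (total P)"
      note ind = indicator_locally_constant[OF co, where 'c = 'r]
      have "?A \<beta> f = ?A \<beta> (\<lambda>x. \<Sum>a\<in>level P \<alpha>. f (section_at \<alpha> a) * indicator (fibre \<alpha> a) x)"
        by (rule arg_cong[OF locally_constant_expansion[OF \<alpha> f]])
      also have "\<dots> = (\<Sum>a\<in>level P \<alpha>. ?A \<beta> (\<lambda>x. f (section_at \<alpha> a) * indicator (fibre \<alpha> a) x))"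
        by (rule distributions_sum[OF D]) (rule locally_constant_scale[OF ind])
      also have "\<dots> = (\<Sum>a\<in>level P \<alpha>. f (section_at \<alpha> a) * ?A \<beta> (indicator (fibre \<alpha> a)))"
        by (rule sum.cong[OF refl]) (rule distributions_scale[OF D ind])
      finally show "?A \<beta> f
          = (\<Sum>a\<in>level P \<alpha>. f (section_at \<alpha> a) * ?A \<beta> (indicator (fibre \<alpha> a)))" .
    qed
    ultimately show ?thesis
      unfolding tendsto_cong[OF ev] by blast
  qed
  define \<mu> where "\<mu> = (\<lambda>f\<in>?L. SOME l. ((\<lambda>\<beta>. ?A \<beta> f) \<longlongrightarrow> l) (tails P))"
  have \<mu>: "((\<lambda>\<beta>. ?A \<beta> f) \<longlongrightarrow> \<mu> f) (tails P)" if "f \<in> ?L" for f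
    unfolding \<mu>_def using that someI_ex[OF conv[OF that]] by simp
  have uniq: "\<mu> f = l" if "f \<in> ?L" "((\<lambda>\<beta>. ?A \<beta> f) \<longlongrightarrow> l) (tails P)" for f l
    using v.tendsto_unique_v[OF tails_nonbot \<mu>[OF that(1)] that(2)] .
  have "\<mu> \<in> distributions (total P)"
  proof (rule distributionsI)
    show "\<mu> \<in> extensional ?L"
      by (simp add: \<mu>_def)
    show "\<mu> (\<lambda>x. f x + g x) = \<mu> f + \<mu> g" if fg: "f \<in> ?L" "g \<in> ?L" for f g
    proof (rule uniq[OF locally_constant_add[OF fg]])
      have ev: "eventually (\<lambda>\<beta>. ?A \<beta> (\<lambda>x. f x + g x) = ?A \<beta> f + ?A \<beta> g) (tails P)"
        using A by (rule eventually_mono) (rule distributions_add[OF _ fg])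
      show "((\<lambda>\<beta>. ?A \<beta> (\<lambda>x. f x + g x)) \<longlongrightarrow> \<mu> f + \<mu> g) (tails P)"
        unfolding tendsto_cong[OF ev] by (rule v.tendsto_add_v[OF \<mu>[OF fg(1)] \<mu>[OF fg(2)]])
    qed
    show "\<mu> (\<lambda>x. c * f x) = c * \<mu> f" if f: "f \<in> ?L" for c f
    proof (rule uniq[OF locally_constant_scale[OF f]])
      have ev: "eventually (\<lambda>\<beta>. ?A \<beta> (\<lambda>x. c * f x) = c * ?A \<beta> f) (tails P)"
        using A by (rule eventually_mono) (rule distributions_scale[OF _ f])
      show "((\<lambda>\<beta>. ?A \<beta> (\<lambda>x. c * f x)) \<longlongrightarrow> c * \<mu> f) (tails P)"
        unfolding tendsto_cong[OF ev] by (rule v.tendsto_mult_v[OF tendsto_const \<mu>[OF f]])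
    qed
  qed
  then have "limitin (weak_star (total P)) ?A \<mu> (tails P)"
    unfolding limitin_weak_star using A \<mu>[OF indicator_locally_constant] by blast
  then show ?thesis
    unfolding procounting_def using \<mu>X by blast
qed

lemma procounting_empty:
  fixes \<mu>X :: "('a \<Rightarrow> 'r::{Q_algebra,topological_space}) \<Rightarrow> 'r"
  assumes "procounting_whole P \<mu>X"
  shows "procounting P {} (\<lambda>f\<in>locally_constant (total P). 0 :: 'r)"
  unfolding procounting_def limitin_weak_star
  using assms zero_distributions[of "total P"] by (auto simp: approx_dist_def)

lemma procounting_empty_indicator:
  fixes v :: "'r::{Q_algebra,topological_space} \<Rightarrow> real" and \<mu> :: "('a \<Rightarrow> 'r) \<Rightarrow> 'r"
  assumes "nontrivial_absolute_value v" "procounting P {} \<mu>" "compact_open (total P) U"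
  shows "\<mu> (indicator U) = 0"
proof -
  obtain \<mu>X where "((\<lambda>\<beta>. approx_dist P \<mu>X {} \<beta> (indicator U)) \<longlongrightarrow> \<mu> (indicator U)) (tails P)"
    using assms(2,3) unfolding procounting_def limitin_weak_star by blast
  then have "((\<lambda>\<beta>. 0) \<longlongrightarrow> \<mu> (indicator U)) (tails P)"
    using indicator_locally_constant[OF assms(3), where 'c = 'r] by (simp add: approx_dist_def)
  then show ?thesis
    using nontrivial_absolute_value.tendsto_unique_v[OF assms(1) tails_nonbot] tendsto_const by metis
qed

text \<open>Nonemptiness of \<open>S\<close> excludes the quotient \<open>0 / 0\<close>, which would
  be 0.\<close>

lemma frequency_topspace:
  assumes "\<beta> \<in> index P" "S \<subseteq> topspace (total P)" "S \<noteq> {}"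
  shows "frequency S (topspace (total P)) \<beta> = 1"
proof -
  have "proj P \<beta> ` S \<subseteq> proj P \<beta> ` topspace (total P)" "finite (proj P \<beta> ` S)"
    using assms(2) finite_subset[OF _ finite_level[OF assms(1)]] proj_in_level[OF assms(1)] by blast+
  then show ?thesis
    using assms(3) by (simp add: frequency_def Int_absorb1 card_eq_0_iff)
qed

text \<open>Total mass 1 is what makes the partial products over finite sets of coordinates
  stationary.\<close>

lemma procounting_topspace:
  fixes v :: "'r::{Q_algebra,topological_space} \<Rightarrow> real" and \<mu> :: "('a \<Rightarrow> 'r) \<Rightarrow> 'r"
  assumes "nontrivial_absolute_value v" "procounting P S \<mu>" "S \<subseteq> topspace (total P)" "S \<noteq> {}"
  shows "\<mu> (indicator (topspace (total P))) = 1"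
proof -
  have "compact_open (total P) (topspace (total P))"
    using compact by (simp add: compact_open_def compact_space_def)
  then have "((\<lambda>\<beta>. of_Q (frequency S (topspace (total P)) \<beta>)) \<longlongrightarrow> \<mu> (indicator (topspace (total P)))) (tails P)"
    using assms(2,4) by (intro procounting_imp_tendsto)
  moreover have ev: "eventually (\<lambda>\<beta>. of_Q (frequency S (topspace (total P)) \<beta>) = (1 :: 'r)) (tails P)"
    using eventually_index by (rule eventually_mono) (simp add: frequency_topspace assms of_Q_1)
  ultimately have "((\<lambda>\<beta>. 1) \<longlongrightarrow> \<mu> (indicator (topspace (total P)))) (tails P)"
    unfolding tendsto_cong[OF ev] by blast
  then show ?thesis
    using nontrivial_absolute_value.tendsto_unique_v[OF assms(1) tails_nonbot] tendsto_const by metis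
qed

end

section \<open>Procounting distributions on a product\<close>

context tower_family
begin

abbreviation frequency_at :: "'i \<Rightarrow> 'a set \<Rightarrow> 'a set \<Rightarrow> 'j \<Rightarrow> rat" where
  "frequency_at n \<equiv> profinite_tower.frequency (Y n)"

abbreviation fibre_at :: "'i \<Rightarrow> 'j \<Rightarrow> 'b \<Rightarrow> 'a set" where
  "fibre_at n \<equiv> profinite_tower.fibre (Y n)"

text \<open>The sides of a fibre of the product, as \<open>fibre_prd\<close> shows: restricted in
  \<open>dom \<alpha>\<close>, the whole space elsewhere.\<close>

definition fibre_box :: "('i \<rightharpoonup> 'j) \<Rightarrow> ('i \<Rightarrow> 'b) \<Rightarrow> 'i \<Rightarrow> 'a set" where
  "fibre_box \<alpha> a n = (if n \<in> dom \<alpha> then fibre_at n (the (\<alpha> n)) (a n) else topspace (total (Y n)))"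

lemma fibre_prd:
  assumes \<alpha>: "\<alpha> \<in> index prd" and a: "a \<in> level prd \<alpha>"
  shows "prd.fibre \<alpha> a = (\<Pi>\<^sub>E n\<in>I. fibre_box \<alpha> a n)"
proof -
  have ext: "a \<in> extensional (dom \<alpha>)"
    using a unfolding level_prd by (simp add: PiE_iff)
  have "x n \<in> fibre_box \<alpha> a n \<longleftrightarrow>
      x n \<in> topspace (total (Y n)) \<and> (n \<in> dom \<alpha> \<longrightarrow> proj (Y n) (the (\<alpha> n)) (x n) = a n)"
    if "n \<in> I" for x n
    using profinite_tower.fibre_def[OF tower[OF that]] by (simp add: fibre_box_def)
  then show ?thesis
    unfolding prd.fibre_def topspace_prd proj_prd_eq[OF ext] set_eq_iff mem_Collect_eq PiE_iff
    using index_prd_subset[OF \<alpha>] by blast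
qed

lemma fibre_box_nonempty:
  assumes \<alpha>: "\<alpha> \<in> index prd" and a: "a \<in> level prd \<alpha>" and n: "n \<in> I"
  shows "fibre_box \<alpha> a n \<noteq> {}"
proof (cases "n \<in> dom \<alpha>")
  case True
  then have "a n \<in> level (Y n) (the (\<alpha> n))"
    using a unfolding level_prd by (rule PiE_mem[rotated])
  then show ?thesis
    using profinite_tower.proj_fibre[OF tower[OF n] index_prd_component[OF \<alpha> True]] True
    unfolding fibre_box_def by (metis image_empty insert_not_empty)
next
  case False
  then show ?thesis
    using profinite_tower.nonempty[OF tower[OF n]] by (simp add: fibre_box_def)
qed

lemma card_level_prd:
  "\<alpha> \<in> index prd \<Longrightarrow> card (level prd \<alpha>) = (\<Prod>n\<in>dom \<alpha>. card (level (Y n) (the (\<alpha> n))))"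
  unfolding level_prd by (simp add: card_PiE index_prd_finite)

lemma indicator_empty_eq: "indicator {} = (\<lambda>x. 0)"
  by (simp add: fun_eq_iff)

text \<open>Fibres are boxes, so cardinalities multiply over \<open>dom \<beta>\<close>. A
  coordinate that enters only at \<beta> is unrestricted and contributes its full level.\<close>

lemma equidistributed_prd:
  assumes equi: "\<And>n. n \<in> I \<Longrightarrow> profinite_tower.equidistributed (Y n)"
  shows "prd.equidistributed"
  unfolding prd.equidistributed_def
proof (intro ballI impI)
  fix \<alpha> \<beta> a
  assume \<alpha>: "\<alpha> \<in> index prd" and \<beta>: "\<beta> \<in> index prd" and leq: "leq prd \<alpha> \<beta>" and a: "a \<in> level prd \<alpha>"
  have dom: "dom \<alpha> \<subseteq> dom \<beta>"
    using leq unfolding leq_prd by blast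
  have "card (proj prd \<beta> ` prd.fibre \<alpha> a)
      = card (\<Pi>\<^sub>E n\<in>dom \<beta>. proj (Y n) (the (\<beta> n)) ` fibre_box \<alpha> a n)"
    unfolding fibre_prd[OF \<alpha> a]
    using proj_prd_PiE_image[OF index_prd_subset[OF \<beta>] fibre_box_nonempty[OF \<alpha> a]] by simp
  also have "\<dots> = (\<Prod>n\<in>dom \<beta>. card (proj (Y n) (the (\<beta> n)) ` fibre_box \<alpha> a n))"
    by (rule card_PiE[OF index_prd_finite[OF \<beta>]])
  finally have fib: "card (proj prd \<beta> ` prd.fibre \<alpha> a)
      = (\<Prod>n\<in>dom \<beta>. card (proj (Y n) (the (\<beta> n)) ` fibre_box \<alpha> a n))" .
  \<comment> \<open>Filling up with factors 1 puts both products over \<open>dom \<beta>\<close>,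
    where they are compared factor by factor.\<close>
  have lev: "card (level prd \<alpha>)
      = (\<Prod>n\<in>dom \<beta>. if n \<in> dom \<alpha> then card (level (Y n) (the (\<alpha> n))) else 1)"
    using dom index_prd_finite[OF \<beta>]
    by (simp add: card_level_prd[OF \<alpha>] prod.If_cases Int_absorb1 flip: domIff)
  have "card (proj (Y n) (the (\<beta> n)) ` fibre_box \<alpha> a n)
      * (if n \<in> dom \<alpha> then card (level (Y n) (the (\<alpha> n))) else 1) = card (level (Y n) (the (\<beta> n)))"
    if n: "n \<in> dom \<beta>" for n
  proof (cases "n \<in> dom \<alpha>")
    case True
    have tow: "profinite_tower (Y n)"
      by (rule tower[OF index_prd_in[OF \<beta> n]])
    have "leq (Y n) (the (\<alpha> n)) (the (\<beta> n))" "a n \<in> level (Y n) (the (\<alpha> n))"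
      using leq True a unfolding leq_prd level_prd by (blast, blast dest: PiE_mem)
    then show ?thesis
      using equi[OF index_prd_in[OF \<beta> n]] index_prd_component[OF \<alpha> True]
        index_prd_component[OF \<beta> n] True
      unfolding profinite_tower.equidistributed_def[OF tow] fibre_box_def by simp
  next
    case False
    then show ?thesis
      using profinite_tower.proj_image[OF tower[OF index_prd_in[OF \<beta> n]] index_prd_component[OF \<beta> n]]
      by (simp add: fibre_box_def)
  qed
  then show "card (proj prd \<beta> ` prd.fibre \<alpha> a) * card (level prd \<alpha>) = card (level prd \<beta>)"
    unfolding fib lev card_level_prd[OF \<beta>] prod.distrib[symmetric] by (rule prod.cong[OF refl])
qed

text \<open>Boxes project to boxes and intersect in boxes. Nonempty sides are needed for the
  projections.\<close>

lemma frequency_prd: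
  assumes \<beta>: "\<beta> \<in> index prd"
    and S: "\<And>n. n \<in> I \<Longrightarrow> S n \<noteq> {}" and U: "\<And>n. n \<in> I \<Longrightarrow> U n \<noteq> {}"
  shows "prd.frequency (\<Pi>\<^sub>E n\<in>I. S n) (\<Pi>\<^sub>E n\<in>I. U n) \<beta>
    = (\<Prod>n\<in>dom \<beta>. frequency_at n (S n) (U n) (the (\<beta> n)))"
proof -
  have "frequency_at n (S n) (U n) (the (\<beta> n))
      = of_nat (card (proj (Y n) (the (\<beta> n)) ` U n \<inter> proj (Y n) (the (\<beta> n)) ` S n))
        / of_nat (card (proj (Y n) (the (\<beta> n)) ` S n))" if "n \<in> dom \<beta>" for n
    by (rule profinite_tower.frequency_def[OF tower[OF index_prd_in[OF \<beta> that]]])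
  moreover have "proj prd \<beta> ` (\<Pi>\<^sub>E n\<in>I. S n) = (\<Pi>\<^sub>E n\<in>dom \<beta>. proj (Y n) (the (\<beta> n)) ` S n)"
    using index_prd_subset[OF \<beta>] S by (rule proj_prd_PiE_image)
  moreover have "proj prd \<beta> ` (\<Pi>\<^sub>E n\<in>I. U n) = (\<Pi>\<^sub>E n\<in>dom \<beta>. proj (Y n) (the (\<beta> n)) ` U n)"
    using index_prd_subset[OF \<beta>] U by (rule proj_prd_PiE_image)
  ultimately show ?thesis
    by (simp add: prd.frequency_def PiE_Int card_PiE[OF index_prd_finite[OF \<beta>]] prod_dividef)
qed

lemma eventually_dom_superset:
  assumes "finite K" "K \<subseteq> I"
  shows "eventually (\<lambda>\<beta>. K \<subseteq> dom \<beta>) (tails prd)"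
proof -
  have "\<exists>\<alpha>. \<alpha> \<in> index (Y n)" if "n \<in> K" for n
    using profinite_tower.index_nonempty[OF tower] that assms(2) by blast
  then obtain g where g: "\<And>n. n \<in> K \<Longrightarrow> g n \<in> index (Y n)"
    by metis
  define \<alpha> where "\<alpha> = (\<lambda>n. if n \<in> K then Some (g n) else None)"
  have dom: "dom \<alpha> = K"
    by (simp add: \<alpha>_def dom_def)
  have "\<alpha> \<in> index prd"
    unfolding index_prd dom using assms g by (simp add: \<alpha>_def)
  moreover have "K \<subseteq> dom \<beta>" if "leq prd \<alpha> \<beta>" for \<beta>
    using that unfolding leq_prd dom by (rule conjunct1)
  ultimately show ?thesis
    unfolding prd.eventually_tails by (intro bexI[of _ \<alpha>] ballI impI)
qed

text \<open>Once \<open>K \<subseteq> dom \<beta>\<close>, the factors outside \<open>K\<close>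
  equal 1, so the product over the varying set \<open>dom \<beta>\<close> becomes one over the fixed
  set \<open>K\<close>, whose factors converge by \<open>filterlim_component\<close>.\<close>

lemma tendsto_frequency_prd:
  fixes v :: "'r::{Q_algebra,topological_space} \<Rightarrow> real"
    and \<mu> :: "'i \<Rightarrow> ('a \<Rightarrow> 'r) \<Rightarrow> 'r"
  assumes v: "nontrivial_absolute_value v" and K: "finite K" "K \<subseteq> I"
    and \<mu>: "\<And>n. n \<in> I \<Longrightarrow> procounting (Y n) (S n) (\<mu> n)"
    and S: "\<And>n. n \<in> I \<Longrightarrow> S n \<noteq> {}" "\<And>n. n \<in> I \<Longrightarrow> S n \<subseteq> topspace (total (Y n))"
    and U: "\<And>n. n \<in> I \<Longrightarrow> U n \<noteq> {}" "\<And>n. n \<in> K \<Longrightarrow> compact_open (total (Y n)) (U n)"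
    and full: "\<And>n. n \<in> I - K \<Longrightarrow> U n = topspace (total (Y n))"
  shows "((\<lambda>\<beta>. of_Q (prd.frequency (\<Pi>\<^sub>E n\<in>I. S n) (\<Pi>\<^sub>E n\<in>I. U n) \<beta>))
    \<longlongrightarrow> (\<Prod>n\<in>K. \<mu> n (indicator (U n)))) (tails prd)"
proof -
  have "eventually (\<lambda>\<beta>. \<beta> \<in> index prd \<and> K \<subseteq> dom \<beta>) (tails prd)"
    using prd.eventually_index eventually_dom_superset[OF K] by (rule eventually_conj)
  then have ev: "eventually (\<lambda>\<beta>. of_Q (prd.frequency (\<Pi>\<^sub>E n\<in>I. S n) (\<Pi>\<^sub>E n\<in>I. U n) \<beta>)
      = (\<Prod>n\<in>K. of_Q (frequency_at n (S n) (U n) (the (\<beta> n))) :: 'r)) (tails prd)"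
  proof (rule eventually_mono)
    fix \<beta>
    assume \<beta>: "\<beta> \<in> index prd \<and> K \<subseteq> dom \<beta>"
    have "frequency_at n (S n) (U n) (the (\<beta> n)) = 1" if "n \<in> dom \<beta> - K" for n
    proof -
      have n: "n \<in> dom \<beta>" "n \<in> I"
        using that \<beta> index_prd_in by blast+
      then have "U n = topspace (total (Y n))"
        using full that by blast
      then show ?thesis
        using profinite_tower.frequency_topspace[OF tower[OF n(2)] index_prd_component[OF _ n(1)]]
          \<beta> S n by simp
    qed
    then have "(\<Prod>n\<in>dom \<beta>. frequency_at n (S n) (U n) (the (\<beta> n)))
        = (\<Prod>n\<in>K. frequency_at n (S n) (U n) (the (\<beta> n)))"
      using \<beta> index_prd_finite by (intro prod.mono_neutral_right) blast+
    then show "of_Q (prd.frequency (\<Pi>\<^sub>E n\<in>I. S n) (\<Pi>\<^sub>E n\<in>I. U n) \<beta>)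
        = (\<Prod>n\<in>K. of_Q (frequency_at n (S n) (U n) (the (\<beta> n))) :: 'r)"
      using frequency_prd[of \<beta> S U] \<beta> S U by (simp add: of_Q_prod)
  qed
  show ?thesis
    unfolding tendsto_cong[OF ev]
  proof (rule nontrivial_absolute_value.tendsto_prod_v[OF v])
    fix n
    assume "n \<in> K"
    then have n: "n \<in> I"
      using K by blast
    show "((\<lambda>\<beta>. of_Q (frequency_at n (S n) (U n) (the (\<beta> n)))) \<longlongrightarrow> \<mu> n (indicator (U n))) (tails prd)"
      using profinite_tower.procounting_imp_tendsto[OF tower[OF n] \<mu>[OF n] S(1)[OF n] U(2)[OF \<open>n \<in> K\<close>]]
        filterlim_component[OF n]
      by (rule filterlim_compose)
  qed
qed

lemma ex_procounting_prd:
  fixes v :: "'r::{Q_algebra,topological_space} \<Rightarrow> real"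
    and \<mu> :: "'i \<Rightarrow> ('a \<Rightarrow> 'r) \<Rightarrow> 'r"
  assumes v: "nontrivial_absolute_value v"
    and whole: "\<And>n. n \<in> I \<Longrightarrow> \<exists>\<nu> :: ('a \<Rightarrow> 'r) \<Rightarrow> 'r. procounting_whole (Y n) \<nu>"
    and S: "\<And>n. n \<in> I \<Longrightarrow> S n \<subseteq> topspace (total (Y n))"
    and \<mu>: "\<And>n. n \<in> I \<Longrightarrow> procounting (Y n) (S n) (\<mu> n)"
  shows "\<exists>\<nu> :: (('i \<Rightarrow> 'a) \<Rightarrow> 'r) \<Rightarrow> 'r. procounting prd (\<Pi>\<^sub>E n\<in>I. S n) \<nu>"
proof -
  have "prd.equidistributed"
  proof (rule equidistributed_prd)
    fix n
    assume n: "n \<in> I"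
    obtain \<nu> :: "('a \<Rightarrow> 'r) \<Rightarrow> 'r" where "procounting_whole (Y n) \<nu>"
      using whole[OF n] by blast
    then show "profinite_tower.equidistributed (Y n)"
      by (rule profinite_tower.procounting_whole_imp_equidistributed[OF tower[OF n]])
  qed
  then obtain \<mu>X :: "(('i \<Rightarrow> 'a) \<Rightarrow> 'r) \<Rightarrow> 'r" where \<mu>X: "procounting_whole prd \<mu>X"
    using prd.ex_procounting_whole by blast
  show ?thesis
  \<comment> \<open>For an empty product the approximations are zero by definition; the box formulas
    require nonempty sides.\<close>
  proof (cases "(\<Pi>\<^sub>E n\<in>I. S n) = {}")
    case True
    then show ?thesis
      using prd.procounting_empty[OF \<mu>X] by metis
  next
    case False
    then have ne: "S n \<noteq> {}" if "n \<in> I" for n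
      using that unfolding PiE_eq_empty_iff by blast
    show ?thesis
    proof (rule prd.ex_procounting[OF v \<mu>X False])
      fix \<alpha> a
      assume \<alpha>: "\<alpha> \<in> index prd" and a: "a \<in> level prd \<alpha>"
      \<comment> \<open>The limit is named explicitly, with \<open>dom \<alpha>\<close> as the set
        of restricted coordinates.\<close>
      have "((\<lambda>\<beta>. of_Q (prd.frequency (\<Pi>\<^sub>E n\<in>I. S n) (\<Pi>\<^sub>E n\<in>I. fibre_box \<alpha> a n) \<beta>))
          \<longlongrightarrow> (\<Prod>n\<in>dom \<alpha>. \<mu> n (indicator (fibre_box \<alpha> a n)))) (tails prd)"
      proof (rule tendsto_frequency_prd[OF v index_prd_finite[OF \<alpha>] index_prd_subset[OF \<alpha>] \<mu> ne S
            fibre_box_nonempty[OF \<alpha> a]])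
        show "compact_open (total (Y n)) (fibre_box \<alpha> a n)" if n: "n \<in> dom \<alpha>" for n
        proof -
          interpret Y: profinite_tower "Y n"
            by (rule tower[OF index_prd_in[OF \<alpha> n]])
          show ?thesis
            using Y.compact_open_saturated[OF index_prd_component[OF \<alpha> n] Y.factors_fibre Y.fibre_subset] n
            by (simp add: fibre_box_def)
        qed
        show "fibre_box \<alpha> a n = topspace (total (Y n))" if "n \<in> I - dom \<alpha>" for n
          using that unfolding fibre_box_def by simp
      qed
      then show "\<exists>l :: 'r. ((\<lambda>\<beta>. of_Q (prd.frequency (\<Pi>\<^sub>E n\<in>I. S n) (prd.fibre \<alpha> a) \<beta>)) \<longlongrightarrow> l) (tails prd)"
        unfolding fibre_prd[OF \<alpha> a] by blast
    qed
  qed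
qed

text \<open>The infinite product is the limit of its finite partial products, and these are constant
  as soon as \<open>F\<close> contains the restricted coordinates, or a single coordinate with
  factor 0.\<close>

lemma procounting_prd_box:
  fixes v :: "'r::{Q_algebra,topological_space} \<Rightarrow> real"
    and \<mu> :: "'i \<Rightarrow> ('a \<Rightarrow> 'r) \<Rightarrow> 'r" and \<nu> :: "(('i \<Rightarrow> 'a) \<Rightarrow> 'r) \<Rightarrow> 'r"
  assumes v: "nontrivial_absolute_value v"
    and S: "\<And>n. n \<in> I \<Longrightarrow> S n \<subseteq> topspace (total (Y n))"
    and \<mu>: "\<And>n. n \<in> I \<Longrightarrow> procounting (Y n) (S n) (\<mu> n)"
    and \<nu>: "procounting prd (\<Pi>\<^sub>E n\<in>I. S n) \<nu>"
    and U: "compact_open (total prd) (\<Pi>\<^sub>E n\<in>I. U n)"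
  shows "\<exists>K. finite K \<and> K \<subseteq> I \<and> (\<forall>F. finite F \<and> K \<subseteq> F \<and> F \<subseteq> I \<longrightarrow>
    (\<Prod>n\<in>F. \<mu> n (indicator (U n))) = \<nu> (indicator (\<Pi>\<^sub>E n\<in>I. U n)))"
proof -
  \<comment> \<open>Taking \<open>K = {m}\<close> excludes those \<open>F\<close> that miss the zero
    factor, such as the empty set.\<close>
  have vanish: ?thesis
    if m: "m \<in> I" "\<mu> m (indicator (U m)) = 0" and "\<nu> (indicator (\<Pi>\<^sub>E n\<in>I. U n)) = 0" for m
  proof (intro exI[of _ "{m}"] conjI allI impI)
    fix F
    assume "finite F \<and> {m} \<subseteq> F \<and> F \<subseteq> I"
    then have "(\<Prod>n\<in>F. \<mu> n (indicator (U n))) = 0"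
      using m(2) by (intro prod_zero) blast+
    then show "(\<Prod>n\<in>F. \<mu> n (indicator (U n))) = \<nu> (indicator (\<Pi>\<^sub>E n\<in>I. U n))"
      using that(3) by simp
  qed (use m in simp_all)
  show ?thesis
  proof (cases "(\<Pi>\<^sub>E n\<in>I. U n) = {}")
    case True
    then obtain m where m: "m \<in> I" "U m = {}"
      unfolding PiE_eq_empty_iff by blast
    have "\<mu> m (indicator (U m)) = 0"
      using distributions_0[OF profinite_tower.procounting_distributions[OF tower[OF m(1)] \<mu>[OF m(1)]]]
      unfolding m(2) indicator_empty_eq .
    moreover have "\<nu> (indicator (\<Pi>\<^sub>E n\<in>I. U n)) = 0"
      using distributions_0[OF prd.procounting_distributions[OF \<nu>]] unfolding True indicator_empty_eq .
    ultimately show ?thesis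
      using m(1) by (intro vanish)
  next
    case False
    then have U_ne: "U n \<noteq> {}" if "n \<in> I" for n
      using that unfolding PiE_eq_empty_iff by blast
    \<comment> \<open>A nonempty box is compact and open only if its sides are; an empty one would
      say nothing about them.\<close>
    have U_co: "compact_open (total (Y n)) (U n)" if "n \<in> I" for n
      using U False that unfolding compact_open_def total_prd openin_PiE_gen compactin_PiE by blast
    show ?thesis
    proof (cases "(\<Pi>\<^sub>E n\<in>I. S n) = {}")
      case True
      then obtain m where m: "m \<in> I" "S m = {}"
        unfolding PiE_eq_empty_iff by blast
      have "\<mu> m (indicator (U m)) = 0"
        using profinite_tower.procounting_empty_indicator[OF tower[OF m(1)] v _ U_co[OF m(1)]]
          \<mu>[OF m(1)] m(2) by simp
      moreover have "\<nu> (indicator (\<Pi>\<^sub>E n\<in>I. U n)) = 0"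
        using prd.procounting_empty_indicator[OF v _ U] \<nu> True by simp
      ultimately show ?thesis
        using m(1) by (intro vanish)
    next
      case nonempty: False
      then have S_ne: "S n \<noteq> {}" if "n \<in> I" for n
        using that unfolding PiE_eq_empty_iff by blast
      \<comment> \<open>Openness of the nonempty box makes this set finite.\<close>
      define K where "K = {n \<in> I. U n \<noteq> topspace (total (Y n))}"
      have K: "finite K" "K \<subseteq> I"
        using U False unfolding K_def compact_open_def total_prd openin_PiE_gen by blast+
      have full: "U n = topspace (total (Y n))" if "n \<in> I - K" for n
        using that unfolding K_def by blast
      have "((\<lambda>\<beta>. of_Q (prd.frequency (\<Pi>\<^sub>E n\<in>I. S n) (\<Pi>\<^sub>E n\<in>I. U n) \<beta>))
          \<longlongrightarrow> (\<Prod>n\<in>K. \<mu> n (indicator (U n)))) (tails prd)"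
        using U_co K(2) by (intro tendsto_frequency_prd[OF v K \<mu> S_ne S U_ne _ full]) blast+
      then have \<nu>_eq: "\<nu> (indicator (\<Pi>\<^sub>E n\<in>I. U n)) = (\<Prod>n\<in>K. \<mu> n (indicator (U n)))"
        using nontrivial_absolute_value.tendsto_unique_v[OF v prd.tails_nonbot
            prd.procounting_imp_tendsto[OF \<nu> nonempty U]] by blast
      have "(\<Prod>n\<in>F. \<mu> n (indicator (U n))) = (\<Prod>n\<in>K. \<mu> n (indicator (U n)))"
        if F: "finite F" "K \<subseteq> F" "F \<subseteq> I" for F
      proof (rule prod.mono_neutral_right[OF F(1,2)], rule ballI)
        fix n
        assume "n \<in> F - K"
        then have n: "n \<in> I" "U n = topspace (total (Y n))"
          using F(3) full by blast+
        then show "\<mu> n (indicator (U n)) = 1"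
          using profinite_tower.procounting_topspace[OF tower[OF n(1)] v \<mu>[OF n(1)] S[OF n(1)] S_ne[OF n(1)]]
          by simp
      qed
      then show ?thesis
        unfolding \<nu>_eq using K by blast
    qed
  qed
qed

end

theorem theoremA:
  fixes v :: "'r::{Q_algebra,topological_space} \<Rightarrow> real"
    and I :: "'i set"
    and Y :: "'i \<Rightarrow> ('a, 'j, 'b) presentation"
    and T :: "'i \<Rightarrow> 'a set"
    and \<mu>T :: "'i \<Rightarrow> ('a \<Rightarrow> 'r) \<Rightarrow> 'r"
  assumes "nontrivial_absolute_value v"
    and "countable I"
    and "\<And>n. n \<in> I \<Longrightarrow> profinite_presentation (Y n)"
    and "\<And>n. n \<in> I \<Longrightarrow> \<exists>\<mu> :: ('a \<Rightarrow> 'r) \<Rightarrow> 'r. procounting_whole (Y n) \<mu>"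
    and "\<And>n. n \<in> I \<Longrightarrow> T n \<subseteq> topspace (total (Y n))"
    and "\<And>n. n \<in> I \<Longrightarrow> procounting (Y n) (T n) (\<mu>T n)"
  shows "(\<exists>\<mu>S :: (('i \<Rightarrow> 'a) \<Rightarrow> 'r) \<Rightarrow> 'r.
      procounting (product_presentation I Y) (\<Pi>\<^sub>E n\<in>I. T n) \<mu>S) \<and>
    (\<forall>(\<mu>S :: (('i \<Rightarrow> 'a) \<Rightarrow> 'r) \<Rightarrow> 'r) U.
      procounting (product_presentation I Y) (\<Pi>\<^sub>E n\<in>I. T n) \<mu>S \<and>
      (\<forall>n\<in>I. U n \<subseteq> topspace (total (Y n))) \<and>
      compact_open (total (product_presentation I Y)) (\<Pi>\<^sub>E n\<in>I. U n) \<longrightarrow>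
        ((\<lambda>F. \<Prod>n\<in>F. \<mu>T n (indicator (U n))) \<longlongrightarrow> \<mu>S (indicator (\<Pi>\<^sub>E n\<in>I. U n)))
          (finite_subsets_at_top I))"
proof -
  interpret tower_family I Y
    by (rule tower_family.intro) (rule profinite_presentation.profinite_tower[OF assms(3)])
  show ?thesis
  proof (intro conjI allI impI)
    show "\<exists>\<mu>S :: (('i \<Rightarrow> 'a) \<Rightarrow> 'r) \<Rightarrow> 'r. procounting prd (\<Pi>\<^sub>E n\<in>I. T n) \<mu>S"
      using assms(1,4,5,6) by (rule ex_procounting_prd)
    fix \<mu>S :: "(('i \<Rightarrow> 'a) \<Rightarrow> 'r) \<Rightarrow> 'r" and U
    assume "procounting prd (\<Pi>\<^sub>E n\<in>I. T n) \<mu>S \<and> (\<forall>n\<in>I. U n \<subseteq> topspace (total (Y n))) \<and>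
      compact_open (total prd) (\<Pi>\<^sub>E n\<in>I. U n)"
    then have "\<exists>K. finite K \<and> K \<subseteq> I \<and> (\<forall>F. finite F \<and> K \<subseteq> F \<and> F \<subseteq> I \<longrightarrow>
        (\<Prod>n\<in>F. \<mu>T n (indicator (U n))) = \<mu>S (indicator (\<Pi>\<^sub>E n\<in>I. U n)))"
      by (intro procounting_prd_box[OF assms(1,5,6)]) blast+
    \<comment> \<open>The existence of \<open>K\<close> is eventual equality along
      \<open>finite_subsets_at_top I\<close>.\<close>
    then show "((\<lambda>F. \<Prod>n\<in>F. \<mu>T n (indicator (U n))) \<longlongrightarrow> \<mu>S (indicator (\<Pi>\<^sub>E n\<in>I. U n)))
        (finite_subsets_at_top I)"
      unfolding eventually_finite_subsets_at_top[symmetric] by (rule tendsto_eventually)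
  qed
qed

end
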